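(* Let $H$ be a complex Hilbert space that is either finite dimensional or separable infinite dimensional, and let $D\in B(H)$ be a nonzero idempotent ($D^2=D$). Then $D$ is zero-diagonal if and only if $D$ is not a Hilbert--Schmidt perturbation of a projection.
   Context: An operator $T\in B(H)$ is zero-diagonal if there is an orthonormal basis $\{e_j\}$ of $H$ with $(Te_j,e_j)=0$ for all $j$. A projection is an operator $P$ with $P^2=P=P^*$. $D$ is a Hilbert--Schmidt perturbation of a projection if $D=P+K$ for some projection $P\in B(H)$ and some Hilbert--Schmidt operator $K$ on $H$. *)

theory Defs
  imports "HOL-Analysis.Analysis"
begin

section \<open>Complex Hilbert spaces\<close>

text \<open>A complex Hilbert space is presented as a real Hilbert space (norm, real inner product,
  completeness from the library) together with a complex scaling extending the real one and a
  sesquilinear form, linear in the first argument, whose real part is the real inner product.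
  This is no restriction: on any complex Hilbert space the real part of the inner product is a
  real inner product inducing the same norm.\<close>

class chilbert_space = real_inner + banach +
  fixes scaleC :: "complex \<Rightarrow> 'a \<Rightarrow> 'a"  (infixr \<open>*\<^sub>C\<close> 75)
    and cinner :: "'a \<Rightarrow> 'a \<Rightarrow> complex"
  assumes scaleC_add_right: "c *\<^sub>C (x + y) = c *\<^sub>C x + c *\<^sub>C y"
    and scaleC_add_left: "(c + d) *\<^sub>C x = c *\<^sub>C x + d *\<^sub>C x"
    and scaleC_scaleC: "c *\<^sub>C d *\<^sub>C x = (c * d) *\<^sub>C x"
    and scaleC_of_real: "complex_of_real r *\<^sub>C x = r *\<^sub>R x"
    and cinner_add_left: "cinner (x + y) z = cinner x z + cinner y z"
    and cinner_scaleC_left: "cinner (c *\<^sub>C x) y = c * cinner x y"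
    and cinner_commute: "cinner x y = cnj (cinner y x)"
    and Re_cinner: "Re (cinner x y) = inner x y"

lemma cinner_self: "cinner x x = complex_of_real ((norm x)\<^sup>2)"
proof -
  have "Im (cinner x x) = 0"
    using arg_cong[OF cinner_commute[of x x], of Im] by simp
  then show ?thesis
    by (simp add: complex_eq_iff Re_cinner power2_norm_eq_inner)
qed

global_interpretation complex_vector: vector_space "scaleC :: complex \<Rightarrow> 'a \<Rightarrow> 'a::chilbert_space"
  defines cspan = complex_vector.span
proof
  fix c d :: complex and x y :: 'a
  show "1 *\<^sub>C x = x"
    using scaleC_of_real[of 1 x] by simp
qed (simp_all add: scaleC_add_right scaleC_add_left scaleC_scaleC)

instantiation complex :: chilbert_space
begin

definition scaleC_complex :: "complex \<Rightarrow> complex \<Rightarrow> complex"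
  where "scaleC_complex c x = c * x"

definition cinner_complex :: "complex \<Rightarrow> complex \<Rightarrow> complex"
  where "cinner_complex x y = x * cnj y"

instance
  by standard (simp_all add: scaleC_complex_def cinner_complex_def inner_complex_def
      algebra_simps scaleR_conv_of_real)

end

definition cfinite_dim :: "'a::chilbert_space set \<Rightarrow> bool"
  where "cfinite_dim S \<longleftrightarrow> (\<exists>B. finite B \<and> S \<subseteq> cspan B)"

text \<open>Orthonormal bases are taken as sets rather than indexed families; an orthonormal family is
  injective, so nothing is lost. The span is the complex one.\<close>

definition orthonormal_basis :: "'a::chilbert_space set \<Rightarrow> bool"
  where "orthonormal_basis E \<longleftrightarrow>
    (\<forall>e\<in>E. \<forall>f\<in>E. cinner e f = (if e = f then 1 else 0)) \<and> closure (cspan E) = UNIV"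


section \<open>Operators\<close>

definition bounded_clinear :: "('a::chilbert_space \<Rightarrow> 'a) \<Rightarrow> bool"
  where "bounded_clinear T \<longleftrightarrow>
    Vector_Spaces.linear scaleC scaleC T \<and> (\<exists>M. \<forall>x. norm (T x) \<le> M * norm x)"

definition zero_diagonal :: "('a::chilbert_space \<Rightarrow> 'a) \<Rightarrow> bool"
  where "zero_diagonal T \<longleftrightarrow> (\<exists>E. orthonormal_basis E \<and> (\<forall>e\<in>E. cinner (T e) e = 0))"

definition is_cadjoint :: "('a::chilbert_space \<Rightarrow> 'a) \<Rightarrow> ('a \<Rightarrow> 'a) \<Rightarrow> bool"
  where "is_cadjoint S T \<longleftrightarrow> (\<forall>x y. cinner (T x) y = cinner x (S y))"

definition projection :: "('a::chilbert_space \<Rightarrow> 'a) \<Rightarrow> bool"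
  where "projection P \<longleftrightarrow> bounded_clinear P \<and> P \<circ> P = P \<and> is_cadjoint P P"

text \<open>Square summability over one orthonormal basis; the sum does not depend on the basis.\<close>

definition hilbert_schmidt :: "('a::chilbert_space \<Rightarrow> 'a) \<Rightarrow> bool"
  where "hilbert_schmidt K \<longleftrightarrow> bounded_clinear K \<and>
    (\<exists>E. orthonormal_basis E \<and> (\<lambda>e. (norm (K e))\<^sup>2) summable_on E)"

definition hs_perturbation_of_projection :: "('a::chilbert_space \<Rightarrow> 'a) \<Rightarrow> bool"
  where "hs_perturbation_of_projection D \<longleftrightarrow>
    (\<exists>P K. projection P \<and> hilbert_schmidt K \<and> D = (\<lambda>x. P x + K x))"

end

theory Submission
  imports Defs
begin

text \<open>Let \<open>P\<close> be the orthogonal projection onto the range of \<open>D\<close>. Then \<open>D\<close> is a Hilbert--Schmidt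
  perturbation of some projection iff \<open>D - P\<close> is Hilbert--Schmidt, because
  \<open>((D - P) f, g) = (K f, g) - (f, K g)\<close> for \<open>g\<close> in the range of \<open>D\<close> whenever \<open>D - K\<close> is self-adjoint.

  If \<open>D - P\<close> is Hilbert--Schmidt and \<open>(De, e) = 0\<close> on an orthonormal basis, then
  \<open>\<parallel>Pe\<parallel> \<le> \<parallel>(D - P)e\<parallel>\<close> makes \<open>P\<close> Hilbert--Schmidt, so \<open>D\<close> has finite rank and its trace 0 equals its
  rank.

  If \<open>D - P\<close> is not Hilbert--Schmidt, consider for \<open>c \<noteq> 1\<close> the space of all \<open>y\<close> with \<open>Dy = c Py\<close>. On it
  \<open>(Dy, y) = c \<parallel>Py\<parallel>\<^sup>2\<close>, and \<open>D - P\<close> factors through the restriction of \<open>P\<close> to it, so the sums of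
  \<open>\<parallel>Py\<parallel>\<^sup>2\<close> over finite orthonormal sets are unbounded there, even on subspaces of finite codimension.
  Choosing the phase of \<open>c\<close> and adjusting the last vector by convexity of the numerical range, every
  complex number is a sum of \<open>(Dy, y)\<close> over a finite orthonormal set orthogonal to given vectors. So
  any unit vector can be completed to a finite orthonormal set on which \<open>D\<close> has trace 0, and a compression
  of trace 0 has zero diagonal in a suitable basis; iterating along a dense sequence gives the basis.\<close>

subsection \<open>Finite orthonormal sets\<close>

abbreviation clinear :: "('a::chilbert_space \<Rightarrow> 'b::chilbert_space) \<Rightarrow> bool"
  where "clinear \<equiv> Vector_Spaces.linear scaleC scaleC"

abbreviation csubspace :: "'a::chilbert_space set \<Rightarrow> bool"
  where "csubspace \<equiv> complex_vector.subspace"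

section \<open>The sesquilinear form: calculation rules, Cauchy-Schwarz, continuity\<close>

lemma cinner_add_right: "cinner x (y + z) = cinner x y + cinner x z"
  by (metis cinner_add_left cinner_commute complex_cnj_add)

lemma cinner_scaleC_right: "cinner x (c *\<^sub>C y) = cnj c * cinner x y"
  by (metis cinner_commute cinner_scaleC_left complex_cnj_mult)

lemma cinner_zero_left [simp]: "cinner 0 x = 0"
  using cinner_add_left[of 0 0 x] by simp

lemma cinner_zero_right [simp]: "cinner x 0 = 0"
  using cinner_add_right[of x 0 0] by simp

lemma cinner_diff_left: "cinner (x - y) z = cinner x z - cinner y z"
  using cinner_add_left[of "x - y" y z] by simp

lemma cinner_diff_right: "cinner x (y - z) = cinner x y - cinner x z"
  using cinner_add_right[of x "y - z" z] by simp

lemma cinner_sum_left: "cinner (sum f A) y = (\<Sum>a\<in>A. cinner (f a) y)"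
  by (induction A rule: infinite_finite_induct) (auto simp: cinner_add_left)

lemma cinner_sum_right: "cinner x (sum f A) = (\<Sum>a\<in>A. cinner x (f a))"
  by (induction A rule: infinite_finite_induct) (auto simp: cinner_add_right)

lemma cinner_eq_0_commute: "cinner x y = 0 \<longleftrightarrow> cinner y x = 0"
  by (metis cinner_commute complex_cnj_zero_iff)

lemma norm_scaleC: "norm (c *\<^sub>C x) = norm c * norm (x::'a::chilbert_space)"
proof -
  have "complex_of_real ((norm (c *\<^sub>C x))\<^sup>2) = complex_of_real ((norm c * norm x)\<^sup>2)"
    unfolding cinner_self[symmetric]
    by (simp add: cinner_scaleC_left cinner_scaleC_right cinner_self[of x] power_mult_distrib
        mult.commute flip: complex_norm_square)
  then have "(norm (c *\<^sub>C x))\<^sup>2 = (norm c * norm x)\<^sup>2"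
    by (rule of_real_eq_iff[THEN iffD1])
  then show ?thesis
    by simp
qed

lemma norm_cinner_le: "norm (cinner x y) \<le> norm x * norm (y::'a::chilbert_space)"
proof (cases "cinner x y = 0")
  case False
  \<comment> \<open>A unimodular factor turns \<open>cinner x y\<close> into its modulus, so that
    the real Cauchy-Schwarz inequality applies.\<close>
  define c where "c = cnj (cinner x y) / norm (cinner x y)"
  have "norm c = 1"
    using False by (simp add: c_def norm_divide)
  have "cinner (c *\<^sub>C x) y = norm (cinner x y)"
    using False complex_norm_square[of "cinner x y"]
    by (simp add: c_def cinner_scaleC_left field_simps power2_eq_square)
  then have "norm (cinner x y) = inner (c *\<^sub>C x) y"
    by (metis Re_cinner Re_complex_of_real)
  also have "\<dots> \<le> norm (c *\<^sub>C x) * norm y"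
    by (rule norm_cauchy_schwarz)
  finally show ?thesis
    by (simp add: norm_scaleC \<open>norm c = 1\<close>)
qed simp

lemma bounded_linear_cinner_left: "bounded_linear (\<lambda>x. cinner x y)"
proof (rule bounded_linear_intro)
  fix r x
  show "cinner (r *\<^sub>R x) y = r *\<^sub>R cinner x y"
    by (metis cinner_scaleC_left scaleC_of_real scaleR_conv_of_real)
  show "norm (cinner x y) \<le> norm x * norm y"
    by (rule norm_cinner_le)
qed (simp add: cinner_add_left)

lemmas tendsto_cinner_left = bounded_linear.tendsto[OF bounded_linear_cinner_left]

section \<open>Complex-linear and bounded operators\<close>

lemma clinear_add: "clinear T \<Longrightarrow> T (x + y) = T x + T y"
  by (simp add: Vector_Spaces.linear_def module_hom_def module_hom_axioms_def)

lemma clinear_scaleC: "clinear T \<Longrightarrow> T (c *\<^sub>C x) = c *\<^sub>C T x"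
  by (simp add: Vector_Spaces.linear_def module_hom_def module_hom_axioms_def)

lemma clinearI:
  fixes T :: "'a::chilbert_space \<Rightarrow> 'b::chilbert_space"
  assumes "\<And>x y. T (x + y) = T x + T y" "\<And>c x. T (c *\<^sub>C x) = c *\<^sub>C T x"
  shows "clinear T"
  using assms
  by (simp add: Vector_Spaces.linear_def module_hom_def module_hom_axioms_def
      complex_vector.vector_space_axioms complex_vector.module_axioms)

lemma clinear_0: "clinear T \<Longrightarrow> T 0 = 0"
  using clinear_add[of T 0 0] by simp

lemma clinear_diff: "clinear T \<Longrightarrow> T (x - y) = T x - T y"
  using clinear_add[of T "x - y" y] by simp

lemma clinear_sum: "clinear T \<Longrightarrow> T (sum f A) = (\<Sum>a\<in>A. T (f a))"
  by (induction A rule: infinite_finite_induct) (auto simp: clinear_add clinear_0)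

lemma clinear_id: "clinear (\<lambda>x. x)"
  by (rule clinearI) auto

lemma bounded_clinear_bounded_linear:
  assumes "bounded_clinear T"
  shows "bounded_linear T"
proof -
  from assms obtain M where T: "clinear T" and M: "\<And>x. norm (T x) \<le> M * norm x"
    unfolding bounded_clinear_def by blast
  show ?thesis
  proof (rule bounded_linear_intro)
    fix r x
    show "T (r *\<^sub>R x) = r *\<^sub>R T x"
      by (metis T clinear_scaleC scaleC_of_real)
    show "norm (T x) \<le> norm x * M"
      using M by (simp add: mult.commute)
  qed (simp add: clinear_add[OF T])
qed

lemma bounded_clinearE:
  assumes "bounded_clinear T"
  obtains M where "M \<ge> 0" "\<And>x. norm (T x) \<le> M * norm x"
  using bounded_linear.nonneg_bounded[OF bounded_clinear_bounded_linear[OF assms]]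
  by (metis mult.commute)

lemma bounded_clinear_iff: "bounded_clinear T \<longleftrightarrow> clinear T \<and> bounded_linear T"
proof
  show "clinear T \<and> bounded_linear T \<Longrightarrow> bounded_clinear T"
    unfolding bounded_clinear_def
    by (metis bounded_linear.nonneg_bounded mult.commute)
qed (simp add: bounded_clinear_bounded_linear, simp add: bounded_clinear_def)

section \<open>Orthonormal sets, orthogonality and subspaces\<close>

definition orthonormal :: "'a::chilbert_space set \<Rightarrow> bool"
  where "orthonormal E \<longleftrightarrow> (\<forall>e\<in>E. \<forall>f\<in>E. cinner e f = (if e = f then 1 else 0))"

lemma orthonormal_subset: "orthonormal E \<Longrightarrow> F \<subseteq> E \<Longrightarrow> orthonormal F"
  unfolding orthonormal_def by blast

lemma orthonormal_empty [simp]: "orthonormal {}"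
  by (simp add: orthonormal_def)

lemma orthonormal_cinner: "orthonormal E \<Longrightarrow> e \<in> E \<Longrightarrow> f \<in> E \<Longrightarrow> cinner e f = (if e = f then 1 else 0)"
  unfolding orthonormal_def by blast

lemma cinner_self_eq_1_iff: "cinner x x = 1 \<longleftrightarrow> norm x = 1"
  by (metis cinner_self norm_ge_zero of_real_1 of_real_eq_iff one_power2 power2_eq_1_iff
      linorder_not_less zero_less_one neg_less_0_iff_less)

lemma orthonormal_norm: "orthonormal E \<Longrightarrow> e \<in> E \<Longrightarrow> norm e = 1"
  by (simp add: orthonormal_cinner flip: cinner_self_eq_1_iff)

lemma orthonormal_Un:
  assumes "orthonormal E" "orthonormal F" "\<And>e f. e \<in> E \<Longrightarrow> f \<in> F \<Longrightarrow> cinner e f = 0"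
  shows "orthonormal (E \<union> F)"
proof -
  have "e \<noteq> f" if "e \<in> E" "f \<in> F" for e f
    using assms that orthonormal_cinner[of E e e] by force
  then show ?thesis
    using assms cinner_eq_0_commute unfolding orthonormal_def by (metis UnE)
qed

lemma orthonormal_insert:
  assumes "orthonormal E" "norm x = 1" "\<And>e. e \<in> E \<Longrightarrow> cinner x e = 0"
  shows "orthonormal (insert x E)"
  using orthonormal_Un[of "{x}" E] assms cinner_self_eq_1_iff[of x]
  by (simp add: orthonormal_def)

lemma orthogonal_cspan:
  assumes "\<And>y. y \<in> Y \<Longrightarrow> cinner x y = 0" "y \<in> cspan Y"
  shows "cinner x y = 0"
  using assms(2)
proof (induction rule: complex_vector.span_induct_alt)
  case (step c y z)
  then show ?case
    by (simp add: assms cinner_add_right cinner_scaleC_right)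
qed simp

definition orth_comp :: "'a::chilbert_space set \<Rightarrow> 'a set"
  where "orth_comp X = {y. \<forall>x\<in>X. cinner y x = 0}"

lemma csubspace_orth_comp: "csubspace (orth_comp X)"
  unfolding complex_vector.subspace_def orth_comp_def
  by (auto simp: cinner_add_left cinner_scaleC_left)

lemma csubspaceI:
  assumes "0 \<in> S" "\<And>x y. x \<in> S \<Longrightarrow> y \<in> S \<Longrightarrow> x + y \<in> S" "\<And>c x. x \<in> S \<Longrightarrow> c *\<^sub>C x \<in> S"
  shows "csubspace S"
  using assms unfolding complex_vector.subspace_def by blast

lemma csubspace_range:
  assumes "clinear T"
  shows "csubspace (range T)"
proof (rule csubspaceI)
  show "0 \<in> range T"
    by (rule range_eqI[of _ _ 0]) (simp add: clinear_0[OF assms])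
next
  fix x y
  assume "x \<in> range T" "y \<in> range T"
  then obtain u v where "x = T u" "y = T v"
    by blast
  then show "x + y \<in> range T"
    by (intro range_eqI[of _ _ "u + v"]) (simp add: clinear_add[OF assms])
next
  fix c x
  assume "x \<in> range T"
  then obtain u where "x = T u"
    by blast
  then show "c *\<^sub>C x \<in> range T"
    by (intro range_eqI[of _ _ "c *\<^sub>C u"]) (simp add: clinear_scaleC[OF assms])
qed

section \<open>Projection onto the span of a finite orthonormal set, Bessel's inequality\<close>

definition oproj :: "'a::chilbert_space set \<Rightarrow> 'a \<Rightarrow> 'a"
  where "oproj F x = (\<Sum>e\<in>F. cinner x e *\<^sub>C e)"

lemma oproj_in_cspan: "oproj F x \<in> cspan F"
  unfolding oproj_def
  by (intro complex_vector.span_sum complex_vector.span_scale complex_vector.span_base)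

lemma cinner_sum_orthonormal:
  assumes "finite F" "orthonormal F" "e \<in> F"
  shows "cinner (\<Sum>f\<in>F. c f *\<^sub>C f) e = c e"
proof -
  have "cinner (\<Sum>f\<in>F. c f *\<^sub>C f) e = (\<Sum>f\<in>F. if f = e then c f else 0)"
    unfolding cinner_sum_left
    by (intro sum.cong) (auto simp: cinner_scaleC_left orthonormal_cinner[OF assms(2) _ assms(3)])
  then show ?thesis
    using assms by simp
qed

lemma norm_sum_orthonormal:
  assumes "finite F" "orthonormal F"
  shows "(norm (\<Sum>f\<in>F. c f *\<^sub>C f))\<^sup>2 = (\<Sum>f\<in>F. (norm (c f))\<^sup>2)"
proof -
  have "cinner (\<Sum>f\<in>F. c f *\<^sub>C f) (\<Sum>f\<in>F. c f *\<^sub>C f) = (\<Sum>f\<in>F. cnj (c f) * c f)"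
    by (subst cinner_sum_right)
      (simp add: cinner_scaleC_right cinner_sum_orthonormal[OF assms])
  also have "\<dots> = complex_of_real (\<Sum>f\<in>F. (norm (c f))\<^sup>2)"
    by (simp only: of_real_sum complex_norm_square mult.commute)
  finally show ?thesis
    unfolding cinner_self by (rule of_real_eq_iff[THEN iffD1])
qed

lemma norm_oproj:
  assumes "finite F" "orthonormal F"
  shows "(norm (oproj F x))\<^sup>2 = (\<Sum>e\<in>F. (norm (cinner x e))\<^sup>2)"
  unfolding oproj_def by (rule norm_sum_orthonormal[OF assms])

lemma cinner_oproj:
  assumes "finite F" "orthonormal F" "y \<in> cspan F"
  shows "cinner (x - oproj F x) y = 0"
  by (rule orthogonal_cspan[OF _ assms(3)])
    (simp add: cinner_diff_left oproj_def cinner_sum_orthonormal assms)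

lemma oproj_cspan:
  assumes "finite F" "orthonormal F" "x \<in> cspan F"
  shows "oproj F x = x"
proof -
  have "cinner (x - oproj F x) (x - oproj F x) = 0"
    by (intro cinner_oproj assms complex_vector.span_diff oproj_in_cspan)
  then show ?thesis
    by (simp add: cinner_self)
qed

lemma norm_add_orthogonal:
  assumes "cinner x y = 0"
  shows "(norm (x + y))\<^sup>2 = (norm x)\<^sup>2 + (norm (y::'a::chilbert_space))\<^sup>2"
  using assms by (metis Re_cinner norm_add_Pythagorean orthogonal_def zero_complex.sel(1))

lemma norm_diff_oproj_le:
  assumes "finite F" "orthonormal F" "y \<in> cspan F"
  shows "norm (x - oproj F x) \<le> norm (x - y)"
proof -
  have "cinner (x - oproj F x) (oproj F x - y) = 0"
    by (intro cinner_oproj assms complex_vector.span_diff oproj_in_cspan)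
  from norm_add_orthogonal[OF this]
  have "(norm (x - oproj F x))\<^sup>2 \<le> (norm (x - y))\<^sup>2"
    by simp
  then show ?thesis
    by (simp add: power2_le_iff_abs_le)
qed

text \<open>This is Bessel's inequality for the adjoint of \<open>T\<close> applied to
  \<open>w\<close>, obtained without constructing the adjoint: \<open>g\<close> is what the
  projection of that vector onto the span of \<open>F\<close> would be, and
  \<open>cinner (T g) w\<close> equals the square of \<open>norm g\<close>.\<close>

lemma bessel_clinear:
  assumes "clinear T" "\<And>x. norm (T x) \<le> M * norm x" "finite F" "orthonormal F"
  shows "(\<Sum>f\<in>F. (norm (cinner (T f) w))\<^sup>2) \<le> (M * norm w)\<^sup>2"
proof -
  define g where "g = (\<Sum>f\<in>F. cnj (cinner (T f) w) *\<^sub>C f)"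
  define q where "q = (\<Sum>f\<in>F. (norm (cinner (T f) w))\<^sup>2)"
  have g: "(norm g)\<^sup>2 = q"
    using norm_sum_orthonormal[OF assms(3,4)] by (simp add: g_def q_def)
  have "cinner (T g) w = (\<Sum>f\<in>F. cnj (cinner (T f) w) * cinner (T f) w)"
    by (simp add: g_def clinear_sum[OF assms(1)] clinear_scaleC[OF assms(1)] cinner_sum_left
        cinner_scaleC_left)
  also have "\<dots> = complex_of_real q"
    by (simp only: q_def of_real_sum complex_norm_square mult.commute)
  finally have "norm (cinner (T g) w) = (norm g)\<^sup>2"
    by (simp add: g[symmetric] norm_power)
  then have "(norm g)\<^sup>2 \<le> norm (T g) * norm w"
    using norm_cinner_le[of "T g" w] by simp
  also have "\<dots> \<le> M * norm g * norm w"
    by (intro mult_right_mono assms) auto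
  finally have *: "norm g * norm g \<le> (M * norm w) * norm g"
    by (simp add: power2_eq_square mult_ac)
  have "norm g \<le> \<bar>M * norm w\<bar>"
  proof (cases "norm g = 0")
    case False
    then show ?thesis
      using * by (simp add: mult_le_cancel_right)
  qed simp
  then show ?thesis
    unfolding q_def[symmetric] g[symmetric] using power_mono[of "norm g" "\<bar>M * norm w\<bar>" 2] by simp
qed

lemma bessel:
  assumes "finite F" "orthonormal F"
  shows "(\<Sum>f\<in>F. (norm (cinner x f))\<^sup>2) \<le> (norm x)\<^sup>2"
proof -
  have "norm (cinner x f) = norm (cinner f x)" for f
    by (metis cinner_commute complex_mod_cnj)
  then show ?thesis
    using bessel_clinear[OF clinear_id, where M=1, OF _ assms, of x] by simp
qed

section \<open>Gram-Schmidt and basis independence of traces\<close>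

lemma gram_schmidt_insert:
  assumes "finite S" "orthonormal S" "x \<notin> cspan S"
  obtains z where "orthonormal (insert z S)" "cspan (insert z S) = cspan (insert x S)"
    "\<And>e. e \<in> S \<Longrightarrow> cinner z e = 0" "norm z = 1"
proof -
  define r where "r = x - oproj S x"
  have "r \<noteq> 0"
    using assms(3) oproj_in_cspan[of S x] by (auto simp: r_def)
  define z where "z = complex_of_real (inverse (norm r)) *\<^sub>C r"
  have n: "norm z = 1"
    using \<open>r \<noteq> 0\<close> by (simp add: z_def norm_scaleC norm_inverse)
  have o: "cinner z e = 0" if "e \<in> S" for e
    using cinner_oproj[OF assms(1,2) complex_vector.span_base[OF that], of x]
    by (simp add: z_def r_def cinner_scaleC_left)
  have x: "x = complex_of_real (norm r) *\<^sub>C z + oproj S x"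
    using \<open>r \<noteq> 0\<close> by (simp add: z_def scaleC_scaleC r_def[symmetric]) (simp add: r_def)
  have sub: "cspan S \<subseteq> cspan (insert u S)" for u
    by (intro complex_vector.span_mono) auto
  have "x \<in> cspan (insert z S)"
    by (subst x) (meson complex_vector.span_add complex_vector.span_scale
        complex_vector.span_base insertI1 oproj_in_cspan sub subsetD)
  moreover have "z \<in> cspan (insert x S)"
    unfolding z_def r_def
    by (meson complex_vector.span_diff complex_vector.span_scale
        complex_vector.span_base insertI1 oproj_in_cspan sub subsetD)
  ultimately have "cspan (insert z S) = cspan (insert x S)"
    using complex_vector.span_superset
    by (intro complex_vector.span_eq[THEN iffD2]) blast
  with that n o orthonormal_insert[OF assms(2)] show ?thesis
    by blast
qed

lemma gram_schmidt:
  assumes "finite X" "finite S" "orthonormal S"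
  obtains S' where "finite S'" "orthonormal S'" "S \<subseteq> S'" "cspan S' = cspan (S \<union> X)"
proof -
  have "\<exists>S'. finite S' \<and> orthonormal S' \<and> S \<subseteq> S' \<and> cspan S' = cspan (S \<union> X)"
    using assms(1)
  proof induction
    case empty
    then show ?case using assms by auto
  next
    case (insert x X)
    then obtain S' where S': "finite S'" "orthonormal S'" "S \<subseteq> S'" "cspan S' = cspan (S \<union> X)"
      by blast
    have eq: "cspan (insert x S') = cspan (S \<union> insert x X)"
      using complex_vector.eq_span_insert_eq[of x x]
      by (metis (no_types) S'(4) Un_insert_right complex_vector.span_insert)
    show ?case
    proof (cases "x \<in> cspan S'")
      case True
      then show ?thesis
        using S' eq by (metis complex_vector.span_redundant)
    next
      case False
      from gram_schmidt_insert[OF S'(1,2) this] S' eq show ?thesis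
        by (metis finite_insert subset_insertI2)
    qed
  qed
  with that show ?thesis by blast
qed

text \<open>Expand each vector of \<open>A\<close> in \<open>B\<close> and exchange the sums. With
  \<open>U\<close> the identity this is invariance of the trace; with \<open>U = T\<close> it is
  invariance of the Hilbert-Schmidt sum.\<close>

lemma trace_eq:
  assumes "finite A" "orthonormal A" "finite B" "orthonormal B" "cspan A = cspan B"
    and T: "clinear T" and U: "clinear U"
  shows "(\<Sum>a\<in>A. cinner (T a) (U a)) = (\<Sum>b\<in>B. cinner (T b) (U b))"
proof -
  have a: "oproj B a = a" if "a \<in> A" for a
    using assms that by (intro oproj_cspan) (auto intro: complex_vector.span_base)
  have b: "oproj A b = b" if "b \<in> B" for b
    using assms that by (intro oproj_cspan) (auto intro: complex_vector.span_base)
  have "(\<Sum>a\<in>A. cinner (T a) (U a)) = (\<Sum>a\<in>A. cinner (T (oproj B a)) (U a))"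
    by (simp add: a)
  also have "\<dots> = (\<Sum>a\<in>A. \<Sum>b\<in>B. cinner (T b) (cinner b a *\<^sub>C U a))"
    by (simp add: oproj_def clinear_sum[OF T] clinear_scaleC[OF T] cinner_sum_left
        cinner_scaleC_left cinner_scaleC_right flip: cinner_commute)
  also have "\<dots> = (\<Sum>b\<in>B. cinner (T b) (U (oproj A b)))"
    by (subst sum.swap)
      (simp add: oproj_def clinear_sum[OF U] clinear_scaleC[OF U] cinner_sum_right)
  also have "\<dots> = (\<Sum>b\<in>B. cinner (T b) (U b))"
    by (simp add: b)
  finally show ?thesis .
qed

subsection \<open>Hilbert--Schmidt bounds over finite orthonormal sets\<close>

lemma finite_orthonormal_spanning:
  assumes "finite X" "csubspace Y" "X \<subseteq> Y"
  obtains G where "finite G" "orthonormal G" "G \<subseteq> Y" "X \<subseteq> cspan G"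
proof -
  from gram_schmidt[OF assms(1), of "{}"] obtain G
    where G: "finite G" "orthonormal G" "cspan G = cspan X"
    by (metis Un_empty_left finite.emptyI orthonormal_empty)
  have "cspan X \<subseteq> Y"
    using assms complex_vector.span_minimal by blast
  with G that show ?thesis
    by (metis complex_vector.span_superset order_trans)
qed

lemma parseval:
  assumes "finite G" "orthonormal G" "x \<in> cspan G"
  shows "(norm x)\<^sup>2 = (\<Sum>g\<in>G. (norm (cinner x g))\<^sup>2)"
  using norm_oproj[OF assms(1,2)] oproj_cspan[OF assms] by metis

text \<open>Ranging over all finite orthonormal subsets of \<open>Y\<close> avoids the choice of a
  basis and makes sense on subspaces that need not be closed.\<close>

definition hs_bounded :: "'a::chilbert_space set \<Rightarrow> ('a \<Rightarrow> 'a) \<Rightarrow> real \<Rightarrow> bool"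
  where "hs_bounded Y T C \<longleftrightarrow>
    (\<forall>F. finite F \<longrightarrow> orthonormal F \<longrightarrow> F \<subseteq> Y \<longrightarrow> (\<Sum>f\<in>F. (norm (T f))\<^sup>2) \<le> C)"

text \<open>The ideal property of Hilbert-Schmidt operators. Parseval and an exchange of sums move
  the square sum from \<open>F\<close> to \<open>H\<close>, Bessel removes \<open>T\<close>, and the
  same exchange leads back to a square sum of \<open>A\<close> over \<open>G\<close>.\<close>

lemma hs_bounded_comp:
  assumes A: "clinear A" and Y: "csubspace Y" and C: "hs_bounded Y A C"
    and T: "clinear T" and M: "\<And>x. norm (T x) \<le> M * norm x" and TY: "\<And>x. T x \<in> Y"
  shows "hs_bounded UNIV (\<lambda>x. A (T x)) (M\<^sup>2 * C)"
  unfolding hs_bounded_def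
proof (intro allI impI)
  fix F :: "'a set"
  assume F: "finite F" "orthonormal F"
  obtain G where G: "finite G" "orthonormal G" "G \<subseteq> Y" "T ` F \<subseteq> cspan G"
    using finite_orthonormal_spanning[of "T ` F" Y] F Y TY by blast
  \<comment> \<open>The span of \<open>H\<close> contains the images under \<open>A\<close> of
    \<open>G\<close> and of the vectors \<open>T f\<close>, so Parseval over \<open>H\<close> is an
    equality at both ends of the estimate.\<close>
  obtain H where H: "finite H" "orthonormal H" "(\<lambda>x. A x) ` (G \<union> T ` F) \<subseteq> cspan H"
    using finite_orthonormal_spanning[of "(\<lambda>x. A x) ` (G \<union> T ` F)" UNIV] F G by auto
  \<comment> \<open>\<open>w h\<close> is the adjoint of the restriction of \<open>A\<close> to the
    span of \<open>G\<close>, applied to \<open>h\<close>.\<close>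
  define w where "w h = (\<Sum>g\<in>G. cnj (cinner (A g) h) *\<^sub>C g)" for h
  have AT: "cinner (A (T f)) h = cinner (T f) (w h)" if "f \<in> F" for f h
  proof -
    have "A (T f) = A (oproj G (T f))"
      using oproj_cspan[OF G(1,2), of "T f"] G(4) that by auto
    then show ?thesis
      by (simp add: oproj_def w_def clinear_sum[OF A] clinear_scaleC[OF A] cinner_sum_left
          cinner_sum_right cinner_scaleC_left cinner_scaleC_right mult.commute)
  qed
  have w: "(norm (w h))\<^sup>2 = (\<Sum>g\<in>G. (norm (cinner (A g) h))\<^sup>2)" for h
    unfolding w_def by (simp add: norm_sum_orthonormal[OF G(1,2)])
  have "(\<Sum>f\<in>F. (norm (A (T f)))\<^sup>2) = (\<Sum>f\<in>F. \<Sum>h\<in>H. (norm (cinner (A (T f)) h))\<^sup>2)"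
    using H by (intro sum.cong refl parseval) auto
  also have "\<dots> = (\<Sum>h\<in>H. \<Sum>f\<in>F. (norm (cinner (T f) (w h)))\<^sup>2)"
    by (subst sum.swap) (simp add: AT)
  also have "\<dots> \<le> (\<Sum>h\<in>H. (M * norm (w h))\<^sup>2)"
    by (intro sum_mono bessel_clinear T M F)
  also have "\<dots> = M\<^sup>2 * (\<Sum>g\<in>G. \<Sum>h\<in>H. (norm (cinner (A g) h))\<^sup>2)"
    by (subst sum.swap) (simp add: power_mult_distrib w sum_distrib_left)
  also have "(\<Sum>g\<in>G. \<Sum>h\<in>H. (norm (cinner (A g) h))\<^sup>2) = (\<Sum>g\<in>G. (norm (A g))\<^sup>2)"
    using H by (intro sum.cong refl parseval[symmetric]) auto
  also have "\<dots> \<le> C"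
    using C G unfolding hs_bounded_def by blast
  finally show "(\<Sum>f\<in>F. (norm (A (T f)))\<^sup>2) \<le> M\<^sup>2 * C"
    by (simp add: mult_left_mono)
qed

text \<open>Within the span of \<open>F\<close> an orthonormal basis can be chosen with at most one
  vector \<open>u\<close> not orthogonal to \<open>f\<close>, namely the normalised projection of
  \<open>f\<close>. The square sum does not change, \<open>u\<close> contributes at most
  \<open>M\<^sup>2\<close>, and the others are covered by \<open>C\<close>.\<close>

lemma hs_bounded_hyperplane:
  assumes T: "clinear T" and M: "\<And>x. norm (T x) \<le> M * norm x" and Y: "csubspace Y"
    and C: "hs_bounded (Y \<inter> orth_comp {f}) T C"
  shows "hs_bounded Y T (M\<^sup>2 + C)"
  unfolding hs_bounded_def
proof (intro allI impI)
  fix F :: "'a set"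
  assume F: "finite F" "orthonormal F" "F \<subseteq> Y"
  define g where "g = oproj F f"
  have g: "cinner f h = cinner g h" if "h \<in> cspan F" for h
    using cinner_oproj[OF F(1,2) that, of f] by (simp add: g_def cinner_diff_left)
  show "(\<Sum>f\<in>F. (norm (T f))\<^sup>2) \<le> M\<^sup>2 + C"
  proof (cases "g = 0")
    case True
    then have "F \<subseteq> orth_comp {f}"
      using g by (auto simp: orth_comp_def complex_vector.span_base cinner_eq_0_commute[of _ f])
    then have "(\<Sum>f\<in>F. (norm (T f))\<^sup>2) \<le> C"
      using C F unfolding hs_bounded_def by blast
    then show ?thesis
      by (simp add: add_increasing)
  next
    case False
    define u where "u = complex_of_real (inverse (norm g)) *\<^sub>C g"
    have u: "norm u = 1"
      using False by (simp add: u_def norm_scaleC norm_inverse)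
    have gu: "g = complex_of_real (norm g) *\<^sub>C u"
      using False by (simp add: u_def scaleC_scaleC)
    have "orthonormal {u}"
      using u by (simp add: orthonormal_def cinner_self_eq_1_iff)
    then obtain S where S: "finite S" "orthonormal S" "u \<in> S" "cspan S = cspan ({u} \<union> F)"
      using gram_schmidt[OF F(1), of "{u}"] by auto
    have "u \<in> cspan F"
      by (simp add: u_def g_def complex_vector.span_scale oproj_in_cspan)
    then have SF: "cspan S = cspan F"
      using S(4) by (simp add: complex_vector.span_redundant)
    have S': "S - {u} \<subseteq> Y \<inter> orth_comp {f}"
    proof
      fix h
      assume h: "h \<in> S - {u}"
      then have hF: "h \<in> cspan F"
        using SF complex_vector.span_base by blast
      then have "h \<in> Y"
        using complex_vector.span_minimal[OF F(3) Y] by blast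
      have "cinner u h = 0"
        using orthonormal_cinner[OF S(2,3)] h by auto
      then have "cinner f h = 0"
        by (subst g[OF hF], subst gu) (simp add: cinner_scaleC_left)
      with \<open>h \<in> Y\<close> show "h \<in> Y \<inter> orth_comp {f}"
        by (simp add: orth_comp_def cinner_eq_0_commute[of _ f])
    qed
    have "complex_of_real (\<Sum>f\<in>F. (norm (T f))\<^sup>2) = complex_of_real (\<Sum>f\<in>S. (norm (T f))\<^sup>2)"
      using trace_eq[OF F(1,2) S(1,2) SF[symmetric] T T] by (simp add: cinner_self)
    then have "(\<Sum>f\<in>F. (norm (T f))\<^sup>2) = (\<Sum>f\<in>S. (norm (T f))\<^sup>2)"
      by (rule of_real_eq_iff[THEN iffD1])
    also have "\<dots> = (norm (T u))\<^sup>2 + (\<Sum>f\<in>S - {u}. (norm (T f))\<^sup>2)"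
      using S by (simp add: sum.remove)
    also have "\<dots> \<le> M\<^sup>2 + C"
    proof (rule add_mono)
      show "(norm (T u))\<^sup>2 \<le> M\<^sup>2"
        using power_mono[OF M[of u], of 2] u by simp
      show "(\<Sum>f\<in>S - {u}. (norm (T f))\<^sup>2) \<le> C"
        using C S S' orthonormal_subset[OF S(2), of "S - {u}"] unfolding hs_bounded_def by auto
    qed
    finally show ?thesis .
  qed
qed

text \<open>Read contrapositively, unboundedness on \<open>Y\<close> survives adding finitely many
  orthogonality conditions. They are imposed one at a time.\<close>

lemma hs_bounded_finite_codim:
  assumes T: "clinear T" and M: "\<And>x. norm (T x) \<le> M * norm x" and "csubspace Y" "finite X"
    and "hs_bounded (Y \<inter> orth_comp X) T C"
  shows "\<exists>C'. hs_bounded Y T C'"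
  using assms(4,3,5)
proof (induction X arbitrary: Y)
  case empty
  then show ?case by (auto simp: orth_comp_def)
next
  case (insert x X)
  have "Y \<inter> orth_comp (insert x X) = Y \<inter> orth_comp {x} \<inter> orth_comp X"
    by (auto simp: orth_comp_def)
  then obtain C' where "hs_bounded (Y \<inter> orth_comp {x}) T C'"
    using insert by (metis complex_vector.subspace_inter csubspace_orth_comp)
  then show ?case
    using hs_bounded_hyperplane[OF T M insert.prems(1)] by blast
qed

subsection \<open>Numerical range and matrices of trace zero\<close>

definition num_range :: "('a::chilbert_space \<Rightarrow> 'a) \<Rightarrow> 'a set \<Rightarrow> complex set"
  where "num_range T S = {cinner (T x) x | x. x \<in> S \<and> norm x = 1}"

text \<open>The Toeplitz--Hausdorff theorem. After an affine normalisation the two given values are 0 and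
  1; a unimodular factor on \<open>y\<close> makes the form real on the segment from \<open>x\<close> to \<open>y\<close>.\<close>

lemma convex_num_range:
  assumes T: "clinear T" and S: "csubspace S"
  shows "convex (num_range T S)"
proof (rule convexI)
  fix a b :: complex and u v :: real
  assume "a \<in> num_range T S" "b \<in> num_range T S" and uv: "0 \<le> u" "0 \<le> v" "u + v = 1"
  then obtain x y where x: "x \<in> S" "norm x = 1" "a = cinner (T x) x"
    and y: "y \<in> S" "norm y = 1" "b = cinner (T y) y"
    unfolding num_range_def by blast
  show "u *\<^sub>R a + v *\<^sub>R b \<in> num_range T S"
  proof (cases "a = b")
    case True
    then have "u *\<^sub>R a + v *\<^sub>R b = a"
      using uv by (metis scaleR_add_left scaleR_one)
    then show ?thesis
      using \<open>a \<in> num_range T S\<close> by simp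
  next
    case False
    define \<phi> where "\<phi> p q = (cinner (T p) q - a * cinner p q) / (b - a)" for p q
    have add_left: "\<phi> (p + p') q = \<phi> p q + \<phi> p' q" for p p' q
      unfolding \<phi>_def by (simp add: clinear_add[OF T] cinner_add_left algebra_simps
          flip: add_divide_distrib diff_divide_distrib)
    have add_right: "\<phi> p (q + q') = \<phi> p q + \<phi> p q'" for p q q'
      unfolding \<phi>_def by (simp add: cinner_add_right algebra_simps
          flip: add_divide_distrib diff_divide_distrib)
    have scale_left: "\<phi> (c *\<^sub>C p) q = c * \<phi> p q" for c p q
      unfolding \<phi>_def by (simp add: clinear_scaleC[OF T] cinner_scaleC_left algebra_simps)
    have scale_right: "\<phi> p (c *\<^sub>C q) = cnj c * \<phi> p q" for c p q
      unfolding \<phi>_def by (simp add: cinner_scaleC_right algebra_simps)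
    have \<phi>x: "\<phi> x x = 0" and \<phi>y: "\<phi> y y = 1"
      using False x y by (simp_all add: \<phi>_def cinner_self)
    \<comment> \<open>The cross term \<open>k\<close> has the same imaginary part as
      \<open>\<omega> * d\<close>, so the phase \<open>\<omega>\<close> is chosen to make that
      product real.\<close>
    define d where "d = \<phi> y x - cnj (\<phi> x y)"
    define \<omega> where "\<omega> = (if d = 0 then 1 else cnj d / norm d)"
    have \<omega>: "norm \<omega> = 1"
      by (simp add: \<omega>_def norm_divide)
    have \<omega>1: "\<omega> * cnj \<omega> = 1"
      using complex_norm_square[of \<omega>] \<omega> by simp
    define k where "k = \<omega> * \<phi> y x + cnj \<omega> * \<phi> x y"
    have "\<omega> * d = complex_of_real (norm d)"
      using complex_norm_square[of d] by (simp add: \<omega>_def field_simps power2_eq_square)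
    then have "Im (\<omega> * d) = 0"
      by simp
    then have "Im k = 0"
      by (simp add: k_def d_def algebra_simps)
    then have k: "k = complex_of_real (Re k)"
      by (simp add: complex_eq_iff)
    define z where "z s = complex_of_real (1 - s) *\<^sub>C x + (complex_of_real s * \<omega>) *\<^sub>C y" for s
    have zR: "z s = (1 - s) *\<^sub>R x + s *\<^sub>R (\<omega> *\<^sub>C y)" for s
      by (simp only: z_def scaleC_of_real flip: scaleC_scaleC)
    define r where "r s = s\<^sup>2 + s * (1 - s) * Re k" for s
    have \<phi>z: "\<phi> (z s) (z s) = complex_of_real (r s)" for s
    proof -
      have "\<phi> (z s) (z s) = s * s * (\<omega> * cnj \<omega>) + s * (1 - s) * k"
        unfolding z_def k_def
        by (simp add: add_left add_right scale_left scale_right \<phi>x \<phi>y) (simp add: algebra_simps)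
      also have "\<dots> = complex_of_real (r s)"
        by (subst k) (simp add: \<omega>1 r_def power2_eq_square)
      finally show ?thesis .
    qed
    \<comment> \<open>At a zero of \<open>g\<close> the normalised vector \<open>z s\<close> has
      value \<open>v\<close> under the form; \<open>g\<close> runs from \<open>- v\<close> to
      \<open>1 - v\<close>.\<close>
    define g where "g s = r s - v * (norm (z s))\<^sup>2" for s
    have "\<exists>s\<ge>0. s \<le> 1 \<and> g s = 0"
    proof (rule IVT')
      show "g 0 \<le> 0"
        using uv x by (simp add: g_def r_def zR)
      show "0 \<le> g 1"
        using uv y \<omega> by (simp add: g_def r_def zR norm_scaleC)
      show "continuous_on {0..1} g"
        unfolding g_def r_def zR by (intro continuous_intros)
    qed simp
    then obtain s where s: "0 \<le> s" "s \<le> 1" "g s = 0"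
      by blast
    \<comment> \<open>Otherwise \<open>x\<close> would be a unimodular multiple of \<open>y\<close>,
      and the form would take the same value at both, whereas these values are 0 and 1.\<close>
    have "z s \<noteq> 0"
    proof
      assume "z s = 0"
      then have eq: "(1 - s) *\<^sub>R x = - (s *\<^sub>R (\<omega> *\<^sub>C y))"
        by (simp add: zR eq_neg_iff_add_eq_0)
      have "1 - s = s"
        using arg_cong[OF eq, of norm] s x y \<omega> by (simp add: norm_scaleC)
      then have "s = 1 / 2"
        by simp
      have "(1 / 2) *\<^sub>R x = (1 / 2) *\<^sub>R ((- \<omega>) *\<^sub>C y)"
        using eq \<open>s = 1 / 2\<close> by (simp add: complex_vector.scale_minus_left)
      then have "x = (- \<omega>) *\<^sub>C y"
        unfolding scaleR_cancel_left by simp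
      then have "\<phi> x x = \<omega> * cnj \<omega> * \<phi> y y"
        by (simp only: scale_left scale_right) simp
      then show False
        by (simp add: \<phi>x \<phi>y \<omega>1)
    qed
    define w where "w = complex_of_real (inverse (norm (z s))) *\<^sub>C z s"
    have nw: "norm w = 1"
      using \<open>z s \<noteq> 0\<close> by (simp add: w_def norm_scaleC norm_inverse)
    have "w \<in> S"
      unfolding w_def z_def using S x y
      by (intro complex_vector.subspace_scale complex_vector.subspace_add)
    have "\<phi> w w = complex_of_real (r s) / complex_of_real ((norm (z s))\<^sup>2)"
      by (simp add: w_def scale_left scale_right \<phi>z power2_eq_square field_simps)
    also have "r s = v * (norm (z s))\<^sup>2"
      using s by (simp add: g_def)
    finally have "\<phi> w w = v"
      using \<open>z s \<noteq> 0\<close> by simp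
    then have "cinner (T w) w = a + v * (b - a)"
      using False nw by (simp add: \<phi>_def cinner_self field_simps)
    also have "\<dots> = u *\<^sub>R a + v *\<^sub>R b"
    proof -
      have "u = 1 - v"
        using uv by simp
      show ?thesis
        unfolding \<open>u = 1 - v\<close> by (simp add: scaleR_conv_of_real algebra_simps)
    qed
    finally show ?thesis
      unfolding num_range_def using nw \<open>w \<in> S\<close> by (intro CollectI exI[of _ w]) simp
  qed
qed

text \<open>Both cardinalities are the trace of the identity on the common span.\<close>

lemma card_orthonormal_eq:
  assumes "finite A" "orthonormal A" "finite B" "orthonormal B" "cspan A = cspan B"
  shows "card A = card B"
proof -
  have "complex_of_nat (card A) = complex_of_nat (card B)"
    using trace_eq[OF assms clinear_id clinear_id] assms by (simp add: orthonormal_cinner)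
  then show ?thesis
    by simp
qed

text \<open>Fillmore's argument: the mean of the diagonal, 0, is in the numerical range by convexity.\<close>

lemma trace_zero_imp_zero_diagonal:
  assumes T: "clinear T" and "finite L" "orthonormal L" "(\<Sum>x\<in>L. cinner (T x) x) = 0"
  shows "\<exists>G. finite G \<and> orthonormal G \<and> cspan G = cspan L \<and> (\<forall>g\<in>G. cinner (T g) g = 0)"
  using assms(2-4)
proof (induction "card L" arbitrary: L)
  case 0
  then show ?case by auto
next
  case (Suc n)
  then have n: "card L > 0" "L \<noteq> {}"
    by auto
  have "(\<Sum>x\<in>L. (1 / real (card L)) *\<^sub>R cinner (T x) x) \<in> num_range T (cspan L)"
  proof (rule convex_sum)
    show "cinner (T x) x \<in> num_range T (cspan L)" if "x \<in> L" for x
      unfolding num_range_def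
      using that complex_vector.span_base orthonormal_norm[OF Suc.prems(2)] by blast
  qed (use Suc.prems n convex_num_range[OF T complex_vector.subspace_span] in auto)
  then have "0 \<in> num_range T (cspan L)"
    by (simp add: Suc.prems flip: scaleR_sum_right)
  then obtain g where g: "g \<in> cspan L" "norm g = 1" "cinner (T g) g = 0"
    unfolding num_range_def by auto
  have "orthonormal {g}"
    using g by (simp add: orthonormal_def cinner_self_eq_1_iff)
  then obtain S where S: "finite S" "orthonormal S" "g \<in> S" "cspan S = cspan ({g} \<union> L)"
    using gram_schmidt[OF Suc.prems(1), of "{g}"] by auto
  then have SL: "cspan S = cspan L"
    using g by (simp add: complex_vector.span_redundant)
  \<comment> \<open>The trace is unchanged on passing to \<open>S\<close>, and \<open>g\<close>
    contributes 0 to it, so \<open>S - {g}\<close> has trace 0 with one vector fewer.\<close>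
  have tr: "(\<Sum>x\<in>S. cinner (T x) x) = 0"
    using trace_eq[OF S(1,2) Suc.prems(1,2) SL T clinear_id] Suc.prems by simp
  have "card S = Suc n"
    using card_orthonormal_eq[OF S(1,2) Suc.prems(1,2) SL] Suc by simp
  then have "n = card (S - {g})" "(\<Sum>x\<in>S - {g}. cinner (T x) x) = 0"
    using S g tr by (auto simp: sum_diff1)
  then obtain G where G: "finite G" "orthonormal G" "cspan G = cspan (S - {g})"
      "\<forall>x\<in>G. cinner (T x) x = 0"
    using Suc.hyps(1)[of "S - {g}"] S orthonormal_subset[OF S(2), of "S - {g}"] by auto
  have "cinner g x = 0" if "x \<in> G" for x
  proof (rule orthogonal_cspan[of "S - {g}"])
    show "x \<in> cspan (S - {g})"
      using G(3) that complex_vector.span_base by blast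
  qed (use orthonormal_cinner[OF S(2,3)] in auto)
  then have "orthonormal (insert g G)"
    using G g by (intro orthonormal_insert)
  moreover have "cspan (insert g G) = cspan (insert g (S - {g}))"
    by (simp only: complex_vector.span_insert G)
  ultimately show ?case
    using G g S SL by (intro exI[of _ "insert g G"]) (auto simp: insert_absorb)
qed

subsection \<open>Orthogonal projections\<close>

text \<open>The nearest point of \<open>S\<close>: a minimising sequence is Cauchy by the
  parallelogram law, and minimality at the limit gives orthogonality.\<close>

lemma orthogonal_decomposition:
  fixes S :: "'a::chilbert_space set"
  assumes "closed S" and S: "csubspace S"
  shows "\<exists>p\<in>S. \<forall>s\<in>S. cinner (x - p) s = 0"
proof -
  define q where "q s = (norm (x - s))\<^sup>2" for s
  define d where "d = Inf (q ` S)"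
  have bdd: "bdd_below (q ` S)"
    by (rule bdd_belowI2[of _ 0]) (simp add: q_def)
  have ne: "q ` S \<noteq> {}"
    using complex_vector.subspace_0[OF S] by blast
  have d: "d \<le> q s" if "s \<in> S" for s
    unfolding d_def using bdd that by (intro cInf_lower) auto
  have "\<exists>s\<in>S. q s < d + inverse (real (Suc n))" for n
    using cInf_lessD[OF ne, of "d + inverse (real (Suc n))"] by (auto simp: d_def)
  then obtain f where f: "\<And>n. f n \<in> S" "\<And>n. q (f n) < d + inverse (real (Suc n))"
    by metis
  have scaleR: "r *\<^sub>R s \<in> S" if "s \<in> S" for r s
    using complex_vector.subspace_scale[OF S that] by (metis scaleC_of_real)
  have parallelogram: "(norm (f n - f m))\<^sup>2 \<le> 2 * inverse (real (Suc n)) + 2 * inverse (real (Suc m))"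
    for n m
  proof -
    \<comment> \<open>The midpoint lies in \<open>S\<close>, so its distance from \<open>x\<close>
      is bounded below by the infimum; this forces \<open>f n\<close> and \<open>f m\<close>
      together.\<close>
    define h where "h = (1 / 2) *\<^sub>R (f n + f m)"
    have "h \<in> S"
      unfolding h_def by (intro scaleR complex_vector.subspace_add[OF S] f)
    have "(x - f n) + (x - f m) = 2 *\<^sub>R (x - h)"
      by (simp add: h_def algebra_simps scaleR_2)
    then have "(norm ((x - f n) + (x - f m)))\<^sup>2 = 4 * q h"
      by (simp add: q_def power_mult_distrib)
    moreover have "(norm (f n - f m))\<^sup>2 + (norm ((x - f n) + (x - f m)))\<^sup>2 = 2 * q (f n) + 2 * q (f m)"
      by (simp add: q_def power2_norm_eq_inner algebra_simps inner_commute)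
    ultimately show ?thesis
      using d[OF \<open>h \<in> S\<close>] f(2)[of n] f(2)[of m] by linarith
  qed
  have "Cauchy f"
  proof (rule CauchyI)
    fix e :: real
    assume "0 < e"
    then obtain N where N: "inverse (real (Suc N)) < e\<^sup>2 / 4"
      using reals_Archimedean[of "e\<^sup>2 / 4"] by auto
    show "\<exists>M. \<forall>m\<ge>M. \<forall>n\<ge>M. norm (f m - f n) < e"
    proof (intro exI allI impI)
      fix m n
      assume "N \<le> m" "N \<le> n"
      then have "inverse (real (Suc m)) \<le> inverse (real (Suc N))"
          "inverse (real (Suc n)) \<le> inverse (real (Suc N))"
        by auto
      then have "(norm (f m - f n))\<^sup>2 < e\<^sup>2"
        using parallelogram[of m n] N by linarith
      then show "norm (f m - f n) < e"
        using \<open>0 < e\<close> by (simp add: power_less_imp_less_base)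
    qed
  qed
  then obtain p where p: "f \<longlonglongrightarrow> p"
    using Cauchy_convergent convergent_def by blast
  have "p \<in> S"
    using closed_sequentially[OF \<open>closed S\<close>] f(1) p by blast
  have "(\<lambda>n. q (f n)) \<longlonglongrightarrow> q p"
    unfolding q_def by (intro tendsto_intros p)
  moreover have "(\<lambda>n. d + inverse (real (Suc n))) \<longlonglongrightarrow> d + 0"
    by (intro tendsto_intros LIMSEQ_inverse_real_of_nat)
  ultimately have "q p \<le> d"
    using f(2) by (intro LIMSEQ_le[of "\<lambda>n. q (f n)" _ _ d]) (auto intro: less_imp_le)
  have re: "inner (x - p) s = 0" if "s \<in> S" for s
  proof (cases "s = 0")
    case False
    \<comment> \<open>The minimiser of the quadratic polynomial \<open>q (p + r *\<^sub>R s)\<close>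
      in \<open>r\<close>.\<close>
    define r where "r = inner (x - p) s / inner s s"
    have "p + r *\<^sub>R s \<in> S"
      by (intro complex_vector.subspace_add[OF S] scaleR that \<open>p \<in> S\<close>)
    then have "q p \<le> q (p + r *\<^sub>R s)"
      using d \<open>q p \<le> d\<close> order_trans by blast
    also have "q (p + r *\<^sub>R s) = q p - 2 * r * inner (x - p) s + r * r * inner s s"
      by (simp add: q_def power2_norm_eq_inner algebra_simps inner_commute)
    also have "\<dots> = q p - (inner (x - p) s)\<^sup>2 / inner s s"
      using False by (simp add: r_def power2_eq_square)
    finally have "(inner (x - p) s)\<^sup>2 / inner s s \<le> 0"
      by simp
    moreover have "\<not> inner s s \<le> 0"
      using False by (simp only: not_le inner_gt_zero_iff not_False_eq_True)
    ultimately show ?thesis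
      by (simp add: divide_le_0_iff)
  qed simp
  have "cinner (x - p) s = 0" if "s \<in> S" for s
  proof -
    \<comment> \<open>Real orthogonality tested on the multiple \<open>c *\<^sub>C s\<close>, which
      also lies in \<open>S\<close>, makes the squared modulus of \<open>c\<close> vanish.\<close>
    define c where "c = cinner (x - p) s"
    have "Re (cnj c * c) = 0"
      using re[OF complex_vector.subspace_scale[OF S that, of c]]
      by (simp add: cinner_scaleC_right c_def flip: Re_cinner)
    then show ?thesis
      by (simp add: c_def[symmetric] complex_eq_iff sum_squares_eq_zero_iff)
  qed
  with \<open>p \<in> S\<close> show ?thesis
    by blast
qed

text \<open>The orthogonal decomposition is unique; linearity follows because sums and multiples of
  decompositions are decompositions.\<close>

lemma projection_exists:
  fixes S :: "'a::chilbert_space set"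
  assumes "closed S" and S: "csubspace S"
  obtains P where "projection P" "\<And>x. P x \<in> S" "\<And>x. x \<in> S \<Longrightarrow> P x = x"
proof -
  from orthogonal_decomposition[OF assms] obtain P
    where P: "\<And>x. P x \<in> S" "\<And>x s. s \<in> S \<Longrightarrow> cinner (x - P x) s = 0"
    by metis
  have unique: "P x = p" if "p \<in> S" "\<And>s. s \<in> S \<Longrightarrow> cinner (x - p) s = 0" for x p
  proof -
    have "P x - p \<in> S"
      using P(1) that(1) S by (intro complex_vector.subspace_diff)
    then have "cinner (P x - p) (P x - p) = 0"
      using P(2)[of _ x] that(2)[of "P x - p"] by (simp add: cinner_diff_left)
    then show ?thesis
      by (simp add: cinner_self)
  qed
  have fix_S: "P x = x" if "x \<in> S" for x
    using that by (intro unique) auto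
  have "clinear P"
  proof (rule clinearI; rule unique)
    fix x y s c
    show "P x + P y \<in> S" "c *\<^sub>C P x \<in> S"
      using P(1) S by (auto intro: complex_vector.subspace_add complex_vector.subspace_scale)
    assume "s \<in> S"
    then show "cinner (x + y - (P x + P y)) s = 0"
      using P(2)[of s x] P(2)[of s y] by (simp add: cinner_diff_left cinner_add_left)
    show "cinner (c *\<^sub>C x - c *\<^sub>C P x) s = 0"
      using P(2)[OF \<open>s \<in> S\<close>, of x] by (simp add: cinner_diff_left cinner_scaleC_left)
  qed
  moreover have "norm (P x) \<le> 1 * norm x" for x
  proof -
    have "(norm ((x - P x) + P x))\<^sup>2 = (norm (x - P x))\<^sup>2 + (norm (P x))\<^sup>2"
      by (rule norm_add_orthogonal) (simp add: P)
    then have "(norm (P x))\<^sup>2 \<le> (norm x)\<^sup>2"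
      by simp
    then show ?thesis
      by (metis mult_1 norm_ge_zero power2_le_imp_le)
  qed
  ultimately have "bounded_clinear P"
    unfolding bounded_clinear_def by blast
  moreover have "is_cadjoint P P"
    unfolding is_cadjoint_def
  proof (intro allI)
    fix x y
    have "cinner (P x) (y - P y) = 0"
      using P(2)[OF P(1), of y x] cinner_eq_0_commute by blast
    then have "cinner (P x) y = cinner (P x) (P y)"
      by (simp add: cinner_diff_right)
    also have "\<dots> = cinner x (P y)"
      using P(2)[OF P(1), of x y] by (simp add: cinner_diff_left)
    finally show "cinner (P x) y = cinner x (P y)" .
  qed
  ultimately have "projection P"
    unfolding projection_def using P fix_S by auto
  with that P fix_S show ?thesis
    by blast
qed

subsection \<open>Orthonormal bases and Hilbert--Schmidt operators\<close>

lemma orthonormal_basis_iff: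
  "orthonormal_basis E \<longleftrightarrow> orthonormal E \<and> closure (cspan E) = UNIV"
  by (simp add: orthonormal_basis_def orthonormal_def)

text \<open>An approximant \<open>y\<close> in the span of \<open>E\<close> already lies in the span
  of a finite \<open>G\<close>; for every finite \<open>F\<close> containing \<open>G\<close>, best
  approximation makes \<open>oproj F x\<close> at least as close to \<open>x\<close>.\<close>

lemma oproj_tendsto:
  assumes "orthonormal_basis E"
  shows "((\<lambda>F. oproj F x) \<longlongrightarrow> x) (finite_subsets_at_top E)"
proof (rule tendstoI)
  fix e :: real
  assume "0 < e"
  have E: "orthonormal E" "x \<in> closure (cspan E)"
    using assms by (simp_all add: orthonormal_basis_iff)
  then obtain y where y: "y \<in> cspan E" "norm (x - y) < e"
    using \<open>0 < e\<close> by (auto simp: closure_approachable dist_norm norm_minus_commute)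
  then obtain G where G: "finite G" "G \<subseteq> E" "y \<in> cspan G"
  proof -
    from y(1) obtain G r where "finite G" "G \<subseteq> E" "y = (\<Sum>a\<in>G. r a *\<^sub>C a)"
      unfolding complex_vector.span_explicit by blast
    moreover have "(\<Sum>a\<in>G. r a *\<^sub>C a) \<in> cspan G"
      by (intro complex_vector.span_sum complex_vector.span_scale complex_vector.span_base)
    ultimately show ?thesis
      using that by blast
  qed
  show "\<forall>\<^sub>F F in finite_subsets_at_top E. dist (oproj F x) x < e"
    unfolding eventually_finite_subsets_at_top
  proof (intro exI conjI allI impI)
    fix F
    assume F: "finite F \<and> G \<subseteq> F \<and> F \<subseteq> E"
    then have "y \<in> cspan F"
      using G complex_vector.span_mono by blast
    then have "norm (x - oproj F x) \<le> norm (x - y)"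
      using F E orthonormal_subset by (intro norm_diff_oproj_le) auto
    then show "dist (oproj F x) x < e"
      using y by (simp add: dist_norm norm_minus_commute)
  qed (use G in auto)
qed

text \<open>Dependent choice absorbs a dense sequence one point at a time into an increasing chain
  of finite orthonormal sets; the union of the chain has dense span. The property \<open>Q\<close>
  concerns single vectors and so passes to the union.\<close>

lemma orthonormal_basis_by_extension:
  fixes Q :: "'a::chilbert_space \<Rightarrow> bool"
  assumes sep: "separable_space (euclidean :: 'a topology)"
    and ext: "\<And>S x. finite S \<Longrightarrow> orthonormal S \<Longrightarrow> \<forall>e\<in>S. Q e \<Longrightarrow>
      \<exists>S'. finite S' \<and> orthonormal S' \<and> (\<forall>e\<in>S'. Q e) \<and> S \<subseteq> S' \<and> x \<in> cspan S'"
  shows "\<exists>E. orthonormal_basis E \<and> (\<forall>e\<in>E. Q e)"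
proof -
  from sep obtain U :: "'a set" where U: "countable U" "closure U = UNIV"
    by (auto simp: separable_space_def)
  then have "U \<noteq> {}"
    by auto
  define d where "d = from_nat_into U"
  have d: "range d = U"
    unfolding d_def using U \<open>U \<noteq> {}\<close> by (simp add: range_from_nat_into)
  define R where "R S \<longleftrightarrow> finite S \<and> orthonormal S \<and> (\<forall>e\<in>S. Q e)" for S
  have "\<exists>f. \<forall>n. R (f n) \<and> (f n \<subseteq> f (Suc n) \<and> d n \<in> cspan (f (Suc n)))"
  proof (rule dependent_nat_choice)
    show "\<exists>S. R S"
      by (rule exI[of _ "{}"]) (simp add: R_def)
    show "\<exists>S'. R S' \<and> S \<subseteq> S' \<and> d n \<in> cspan S'" if "R S" for S n
      using ext[of S "d n"] that unfolding R_def by blast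
  qed
  then obtain f where f: "\<And>n. R (f n)" "\<And>n. f n \<subseteq> f (Suc n)" "\<And>n. d n \<in> cspan (f (Suc n))"
    by blast
  define E where "E = (\<Union>n. f n)"
  have mono: "f m \<subseteq> f n" if "m \<le> n" for m n
    using lift_Suc_mono_le[of f] f(2) that by blast
  have "orthonormal E"
    unfolding orthonormal_def
  proof (intro ballI)
    fix a b
    assume "a \<in> E" "b \<in> E"
    then obtain m n where "a \<in> f m" "b \<in> f n"
      by (auto simp: E_def)
    then have "a \<in> f (max m n)" "b \<in> f (max m n)"
      using mono[of m "max m n"] mono[of n "max m n"] by auto
    then show "cinner a b = (if a = b then 1 else 0)"
      using f(1)[of "max m n"] orthonormal_cinner unfolding R_def by blast
  qed
  moreover have "U \<subseteq> cspan E"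
  proof -
    have "cspan (f n) \<subseteq> cspan E" for n
      by (rule complex_vector.span_mono) (auto simp: E_def)
    then show ?thesis
      using f(3) d by blast
  qed
  then have "closure U \<subseteq> closure (cspan E)"
    by (rule closure_mono)
  then have "closure (cspan E) = UNIV"
    using U(2) by auto
  moreover have "\<forall>e\<in>E. Q e"
    using f(1) by (auto simp: E_def R_def)
  ultimately show ?thesis
    by (auto simp: orthonormal_basis_iff)
qed

lemma orthonormal_basis_exists:
  assumes "separable_space (euclidean :: 'a::chilbert_space topology)"
  shows "\<exists>E :: 'a set. orthonormal_basis E"
proof -
  have "\<exists>S'. finite S' \<and> orthonormal S' \<and> (\<forall>e\<in>S'. True) \<and> S \<subseteq> S' \<and> x \<in> cspan S'"
    if "finite S" "orthonormal S" for S :: "'a set" and x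
  proof -
    obtain S' where "finite S'" "orthonormal S'" "S \<subseteq> S'" "cspan S' = cspan (S \<union> {x})"
      using gram_schmidt[of "{x}" S] \<open>finite S\<close> \<open>orthonormal S\<close> by (metis finite.emptyI finite.insertI)
    moreover have "x \<in> cspan (S \<union> {x})"
      by (rule complex_vector.span_base) simp
    ultimately show ?thesis
      by auto
  qed
  from orthonormal_basis_by_extension[OF assms this] show ?thesis
    by blast
qed

lemma finite_orthonormal_basis_exists:
  assumes "cfinite_dim (UNIV :: 'a::chilbert_space set)"
  shows "\<exists>E :: 'a set. finite E \<and> orthonormal_basis E"
proof -
  from assms obtain B :: "'a set" where B: "finite B" "cspan B = UNIV"
    unfolding cfinite_dim_def by auto
  obtain E where "finite E" "orthonormal E" "cspan E = cspan ({} \<union> B)"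
    using gram_schmidt[OF B(1), of "{}"] by auto
  with B show ?thesis
    by (auto simp: orthonormal_basis_iff)
qed

lemma hilbert_schmidtI:
  fixes K :: "'a::chilbert_space \<Rightarrow> 'a" and E :: "'a set"
  assumes "bounded_clinear K" "orthonormal_basis E" "hs_bounded UNIV K C"
  shows "hilbert_schmidt K"
  unfolding hilbert_schmidt_def
proof (intro conjI exI)
  have "orthonormal E"
    using assms by (simp add: orthonormal_basis_iff)
  show "(\<lambda>e. (norm (K e))\<^sup>2) summable_on E"
  proof (rule nonneg_bdd_above_summable_on)
    show "bdd_above (sum (\<lambda>e. (norm (K e))\<^sup>2) ` {F. F \<subseteq> E \<and> finite F})"
      using assms(3) orthonormal_subset[OF \<open>orthonormal E\<close>]
      by (intro bdd_aboveI2[of _ _ C]) (auto simp: hs_bounded_def)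
  qed auto
qed (use assms in auto)

text \<open>The bound passes from the given basis to arbitrary finite orthonormal sets: replace each
  \<open>f\<close> by its projection onto a finite part \<open>S\<close> of the basis, estimate
  uniformly in \<open>S\<close>, and take the limit.\<close>

lemma hilbert_schmidt_hs_bounded:
  assumes "hilbert_schmidt K"
  shows "\<exists>C. hs_bounded UNIV K C"
proof -
  from assms obtain E where K: "clinear K" "bounded_linear K" and E: "orthonormal_basis E"
    and sum: "(\<lambda>e. (norm (K e))\<^sup>2) summable_on E"
    unfolding hilbert_schmidt_def bounded_clinear_iff by blast
  define C where "C = infsum (\<lambda>e. (norm (K e))\<^sup>2) E"
  have "(\<Sum>f\<in>F. (norm (K f))\<^sup>2) \<le> C" if F: "finite F" "orthonormal F" for F
  proof (rule tendsto_upperbound)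
    show "((\<lambda>S. \<Sum>f\<in>F. (norm (K (oproj S f)))\<^sup>2) \<longlongrightarrow> (\<Sum>f\<in>F. (norm (K f))\<^sup>2))
        (finite_subsets_at_top E)"
      by (intro tendsto_intros bounded_linear.tendsto[OF K(2)] oproj_tendsto E)
    have le: "(\<Sum>f\<in>F. (norm (K (oproj S f)))\<^sup>2) \<le> C" if S: "finite S" "S \<subseteq> E" for S
    proof -
      have oS: "orthonormal S"
        using E S orthonormal_subset by (auto simp: orthonormal_basis_iff)
      \<comment> \<open>An orthonormal set in the span of \<open>S\<close> extends to an orthonormal
        basis of that span, whose square sum is the one over \<open>S\<close>.\<close>
      have "hs_bounded (cspan S) K (\<Sum>e\<in>S. (norm (K e))\<^sup>2)"
        unfolding hs_bounded_def
      proof (intro allI impI)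
        fix G
        assume G: "finite G" "orthonormal G" "G \<subseteq> cspan S"
        obtain G' where G': "finite G'" "orthonormal G'" "G \<subseteq> G'" "cspan G' = cspan (G \<union> S)"
          using gram_schmidt[OF S(1) G(1,2)] by blast
        have "cspan (G \<union> S) = cspan S"
          using G(3) complex_vector.span_superset[of S] complex_vector.span_superset[of "G \<union> S"]
          by (subst complex_vector.span_eq) blast
        with G'(4) have "cspan G' = cspan S"
          by simp
        then have "complex_of_real (\<Sum>e\<in>G'. (norm (K e))\<^sup>2) = complex_of_real (\<Sum>e\<in>S. (norm (K e))\<^sup>2)"
          using trace_eq[OF G'(1,2) S(1) oS _ K(1) K(1)] by (simp add: cinner_self)
        then have "(\<Sum>e\<in>G'. (norm (K e))\<^sup>2) = (\<Sum>e\<in>S. (norm (K e))\<^sup>2)"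
          by (rule of_real_eq_iff[THEN iffD1])
        then show "(\<Sum>e\<in>G. (norm (K e))\<^sup>2) \<le> (\<Sum>e\<in>S. (norm (K e))\<^sup>2)"
          using sum_mono2[of G' G "\<lambda>e. (norm (K e))\<^sup>2"] G' by simp
      qed
      moreover have "clinear (oproj S)"
        by (rule clinearI) (simp_all add: oproj_def cinner_add_left cinner_scaleC_left
            scaleC_add_left sum.distrib complex_vector.scale_sum_right scaleC_scaleC)
      moreover have "norm (oproj S x) \<le> 1 * norm x" for x
        using norm_oproj[OF S(1) oS, of x] bessel[OF S(1) oS, of x]
        by (simp add: power2_le_imp_le)
      ultimately have "hs_bounded UNIV (\<lambda>x. K (oproj S x)) (1\<^sup>2 * (\<Sum>e\<in>S. (norm (K e))\<^sup>2))"
        using K(1) oproj_in_cspan by (intro hs_bounded_comp[where Y="cspan S"]) auto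
      then have "(\<Sum>f\<in>F. (norm (K (oproj S f)))\<^sup>2) \<le> (\<Sum>e\<in>S. (norm (K e))\<^sup>2)"
        using F by (simp add: hs_bounded_def)
      also have "\<dots> \<le> C"
        unfolding C_def using S by (intro finite_sum_le_infsum sum) auto
      finally show ?thesis .
    qed
    show "\<forall>\<^sub>F S in finite_subsets_at_top E. (\<Sum>f\<in>F. (norm (K (oproj S f)))\<^sup>2) \<le> C"
      unfolding eventually_finite_subsets_at_top using le by (intro exI[of _ "{}"]) auto
  qed simp
  then show ?thesis
    unfolding hs_bounded_def by blast
qed

subsection \<open>Idempotents\<close>

text \<open>\<open>PD\<close> and \<open>DP\<close> together say that \<open>P\<close> and
  \<open>D\<close> have the same range, so \<open>P\<close> is the orthogonal projection onto the
  range of \<open>D\<close>.\<close>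

locale idempotent =
  fixes D P :: "'a::chilbert_space \<Rightarrow> 'a"
  assumes D: "bounded_clinear D" and DD: "\<And>x. D (D x) = D x"
    and P: "projection P" and PD: "\<And>x. P (D x) = D x" and DP: "\<And>x. D (P x) = P x"
begin

lemma D_lin: "clinear D" and D_bounded: "bounded_linear D"
  using D by (simp_all add: bounded_clinear_iff)

lemma P_lin: "clinear P" and P_bounded: "bounded_linear P"
  and P_adj: "cinner (P x) y = cinner x (P y)"
  using P by (auto simp: projection_def is_cadjoint_def bounded_clinear_iff)

lemma PP: "P (P x) = P x"
  using P unfolding projection_def by (metis comp_apply)

lemma cinner_P: "cinner (P x) x = complex_of_real ((norm (P x))\<^sup>2)"
  by (metis P_adj PP cinner_self)

lemma D_minus_P: "bounded_clinear (\<lambda>x. D x - P x)"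
  unfolding bounded_clinear_iff
  using clinear_add[OF D_lin] clinear_add[OF P_lin] clinear_scaleC[OF D_lin] clinear_scaleC[OF P_lin]
  by (intro conjI clinearI bounded_linear_sub D_bounded P_bounded)
    (simp_all add: complex_vector.scale_right_diff_distrib)

section \<open>Subspaces on which the quadratic form of \<open>D\<close> takes values on the ray
  through \<open>c\<close>\<close>

definition ray_space :: "complex \<Rightarrow> 'a set"
  where "ray_space c = {y. D y = c *\<^sub>C P y}"

lemma csubspace_ray_space: "csubspace (ray_space c)"
  by (rule csubspaceI) (auto simp: ray_space_def clinear_0[OF D_lin] clinear_0[OF P_lin]
      clinear_add[OF D_lin] clinear_add[OF P_lin] clinear_scaleC[OF D_lin] clinear_scaleC[OF P_lin]
      scaleC_add_right scaleC_scaleC mult.commute)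

lemma cinner_ray_space:
  "y \<in> ray_space c \<Longrightarrow> cinner (D y) y = c * complex_of_real ((norm (P y))\<^sup>2)"
  by (simp add: ray_space_def cinner_scaleC_left cinner_P)

lemma hs_bounded_ray_space:
  assumes c: "c \<noteq> 1" and C: "hs_bounded (ray_space c) P C"
  shows "\<exists>C'. hs_bounded UNIV (\<lambda>x. D x - P x) C'"
proof -
  \<comment> \<open>With \<open>v = x - P x\<close> one has \<open>D v = D x - P x\<close>, hence
    \<open>P (T x) = s *\<^sub>C D v\<close> and \<open>D (T x) = (1 + s) *\<^sub>C D v\<close>. The
    value of \<open>s\<close> solves \<open>1 + s = c * s\<close>, and multiplication by
    \<open>c - 1\<close> in \<open>A\<close> then recovers \<open>D x - P x\<close>.\<close>
  define s where "s = 1 / (c - 1)"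
  define T where "T x = (x - P x) + s *\<^sub>C (D x - P x)" for x
  define A where "A y = (c - 1) *\<^sub>C P y" for y
  have T_lin: "clinear T"
    by (rule clinearI) (simp_all add: T_def clinear_add[OF D_lin] clinear_add[OF P_lin]
        clinear_scaleC[OF D_lin] clinear_scaleC[OF P_lin] scaleC_add_right scaleC_scaleC
        complex_vector.scale_right_diff_distrib mult.commute)
  have "bounded_clinear T"
  proof -
    obtain M where M: "\<And>x. norm (P x) \<le> M * norm x"
      using P unfolding projection_def by (metis bounded_clinearE)
    obtain N where N: "\<And>x. norm (D x - P x) \<le> N * norm x"
      using D_minus_P by (metis bounded_clinearE)
    have "norm (T x) \<le> (1 + M + norm s * N) * norm x" for x
    proof -
      have "norm (T x) \<le> norm (x - P x) + norm (s *\<^sub>C (D x - P x))"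
        unfolding T_def by (rule norm_triangle_ineq)
      also have "\<dots> \<le> norm x + norm (P x) + norm s * norm (D x - P x)"
        by (simp add: norm_scaleC norm_triangle_ineq4)
      also have "\<dots> \<le> norm x + M * norm x + norm s * (N * norm x)"
        by (intro add_mono mult_left_mono M N) auto
      finally show ?thesis
        by (simp add: algebra_simps)
    qed
    then show ?thesis
      unfolding bounded_clinear_def using T_lin by blast
  qed
  then obtain M where M: "\<And>x. norm (T x) \<le> M * norm x"
    by (metis bounded_clinearE)
  have PT: "P (T x) = s *\<^sub>C (D x - P x)" for x
    by (simp add: T_def clinear_add[OF P_lin] clinear_diff[OF P_lin] clinear_scaleC[OF P_lin] PP PD)
  have DT: "D (T x) = (1 + s) *\<^sub>C (D x - P x)" for x
    by (simp add: T_def clinear_add[OF D_lin] clinear_diff[OF D_lin] clinear_scaleC[OF D_lin] DD DP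
        scaleC_add_left)
  have "1 + s = c * s"
    using c by (simp add: s_def field_simps)
  then have T: "T x \<in> ray_space c" for x
    by (simp add: ray_space_def PT DT scaleC_scaleC)
  have AT: "A (T x) = D x - P x" for x
    using c by (simp add: A_def PT scaleC_scaleC s_def)
  have "clinear A"
    by (rule clinearI) (simp_all add: A_def clinear_add[OF P_lin] clinear_scaleC[OF P_lin]
        scaleC_add_right scaleC_scaleC mult.commute)
  moreover have "hs_bounded (ray_space c) A ((norm (c - 1))\<^sup>2 * C)"
    using C by (simp add: hs_bounded_def A_def norm_scaleC power_mult_distrib mult_left_mono
        flip: sum_distrib_left)
  ultimately have "hs_bounded UNIV (\<lambda>x. A (T x)) (M\<^sup>2 * ((norm (c - 1))\<^sup>2 * C))"
    using csubspace_ray_space T_lin M T by (intro hs_bounded_comp[where Y="ray_space c"])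
  then show ?thesis
    by (auto simp: AT)
qed

text \<open>Vectors of \<open>ray_space c\<close> give values on the ray towards \<open>w\<close>.
  They are collected until the next one would overshoot; that one is replaced by a unit vector with
  exactly the missing value, found by convexity between the two opposite rays.\<close>

lemma trace_realisation:
  assumes unb: "\<And>C. \<not> hs_bounded UNIV (\<lambda>x. D x - P x) C" and X: "finite X"
  shows "\<exists>F. finite F \<and> orthonormal F \<and> F \<subseteq> orth_comp X \<and> (\<Sum>y\<in>F. cinner (D y) y) = w"
proof (cases "w = 0")
  case True
  then show ?thesis
    by (intro exI[of _ "{}"]) auto
next
  case False
  define r where "r = norm w"
  \<comment> \<open>The modulus 2 keeps both \<open>c\<close> and \<open>- c\<close> away from 1.
    Since \<open>w\<close> is \<open>r / 2\<close> times \<open>c\<close>, the squared norms of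
    \<open>P y\<close> have to add up to \<open>r / 2\<close>.\<close>
  define c where "c = 2 * w / complex_of_real r"
  have r: "r > 0"
    using False by (simp add: r_def)
  have "norm c = 2"
    using r by (simp add: c_def norm_divide norm_mult r_def)
  then have c: "norm c \<noteq> norm (1 :: complex)" "norm (- c) \<noteq> norm (1 :: complex)"
    by simp_all
  then have c: "c \<noteq> 1" "- c \<noteq> 1"
    by metis+
  have w: "w = complex_of_real (r / 2) * c"
    using r by (simp add: c_def)
  obtain M where M: "\<And>x. norm (P x) \<le> M * norm x"
    using P unfolding projection_def by (metis bounded_clinearE)
  have unb_ray: "\<not> hs_bounded (ray_space c' \<inter> orth_comp Y) P C"
    if "c' \<noteq> 1" "finite Y" for c' Y C
  proof
    assume "hs_bounded (ray_space c' \<inter> orth_comp Y) P C"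
    then obtain C' where "hs_bounded (ray_space c') P C'"
      using hs_bounded_finite_codim[OF P_lin M csubspace_ray_space \<open>finite Y\<close>] by blast
    from hs_bounded_ray_space[OF \<open>c' \<noteq> 1\<close> this] unb show False
      by blast
  qed
  obtain F where F: "finite F" "orthonormal F" "F \<subseteq> ray_space c \<inter> orth_comp X"
      "r / 2 < (\<Sum>y\<in>F. (norm (P y))\<^sup>2)"
    using unb_ray[OF c(1) X, of "r / 2"] by (auto simp: hs_bounded_def not_le)
  have "\<exists>G y. G \<subseteq> F \<and> y \<in> F - G \<and> (\<Sum>y\<in>G. (norm (P y))\<^sup>2) \<le> r / 2 \<and>
      r / 2 < (\<Sum>y\<in>insert y G. (norm (P y))\<^sup>2)"
    using F(1,4)
  proof (induction F)
    case empty
    then show ?case using r by simp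
  next
    case (insert y F)
    show ?case
    proof (cases "r / 2 < (\<Sum>y\<in>F. (norm (P y))\<^sup>2)")
      case True
      then show ?thesis using insert.IH by blast
    next
      case False
      then show ?thesis using insert by (intro exI[of _ F] exI[of _ y]) auto
    qed
  qed
  then obtain G y where G: "G \<subseteq> F" "y \<in> F" "y \<notin> G"
    and Gr: "(\<Sum>y\<in>G. (norm (P y))\<^sup>2) \<le> r / 2" "r / 2 < (\<Sum>y\<in>insert y G. (norm (P y))\<^sup>2)"
    by blast
  \<comment> \<open>The missing amount; the vector \<open>y\<close> alone would exceed it.\<close>
  define t where "t = r / 2 - (\<Sum>y\<in>G. (norm (P y))\<^sup>2)"
  have finG: "finite G"
    using F G finite_subset by blast
  have t: "0 \<le> t" "t < (norm (P y))\<^sup>2"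
    using Gr G finG by (auto simp: t_def)
  define S where "S = orth_comp (X \<union> G)"
  have "cinner y g = 0" if "g \<in> G" for g
    using orthonormal_cinner[OF F(2) G(2), of g] that G by auto
  then have "y \<in> S"
    using F(3) G by (auto simp: S_def orth_comp_def)
  moreover have "norm y = 1"
    using orthonormal_norm F G by blast
  moreover have "cinner (D y) y = c * complex_of_real ((norm (P y))\<^sup>2)"
    using cinner_ray_space F(3) G by blast
  ultimately have y_range: "c * complex_of_real ((norm (P y))\<^sup>2) \<in> num_range D S"
    unfolding num_range_def by (intro CollectI exI[of _ y]) simp
  \<comment> \<open>Unboundedness on the opposite ray space, even orthogonally to \<open>X\<close>
    and \<open>G\<close>, supplies a unit vector \<open>z\<close> there with \<open>P z\<close>
    nonzero.\<close>
  obtain H where H: "finite H" "orthonormal H" "H \<subseteq> ray_space (- c) \<inter> S"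
      "0 < (\<Sum>y\<in>H. (norm (P y))\<^sup>2)"
    using unb_ray[OF c(2), of "X \<union> G" 0] X finG by (auto simp: hs_bounded_def not_le S_def)
  then have "\<exists>z\<in>H. norm (P z) \<noteq> 0"
  proof -
    have "H \<noteq> {} \<and> (\<exists>z\<in>H. (norm (P z))\<^sup>2 \<noteq> 0)"
      using H(4) sum.neutral[of H "\<lambda>y. (norm (P y))\<^sup>2"] by (metis less_irrefl sum.empty)
    then show ?thesis
      by auto
  qed
  then obtain z where z: "z \<in> H" "norm (P z) \<noteq> 0"
    by blast
  have "cinner (D z) z = - c * complex_of_real ((norm (P z))\<^sup>2)"
    using cinner_ray_space H(3) z by blast
  moreover have "z \<in> S" "norm z = 1"
    using H z orthonormal_norm by blast+
  ultimately have z_range: "- c * complex_of_real ((norm (P z))\<^sup>2) \<in> num_range D S"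
    unfolding num_range_def by (intro CollectI exI[of _ z]) simp
  define p q where "p = (norm (P y))\<^sup>2" and "q = (norm (P z))\<^sup>2"
  have pq: "0 < p" "0 < q" "t < p"
    using t z by (auto simp: p_def q_def)
  \<comment> \<open>The weight with \<open>u * p - (1 - u) * q = t\<close>, which places
    \<open>c * t\<close> on the segment from \<open>- c * q\<close> to \<open>c * p\<close>.\<close>
  define u where "u = (t + q) / (p + q)"
  have u: "0 \<le> u" "u \<le> 1"
    using pq t by (auto simp: u_def field_simps)
  have "u *\<^sub>R (c * complex_of_real p) + (1 - u) *\<^sub>R (- c * complex_of_real q) \<in> num_range D S"
    using y_range z_range u unfolding p_def q_def
    by (intro convexD[OF convex_num_range[OF D_lin]]) (auto simp: S_def csubspace_orth_comp)
  moreover have "u *\<^sub>R (c * complex_of_real p) + (1 - u) *\<^sub>R (- c * complex_of_real q)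
      = c * complex_of_real (u * (p + q) - q)"
    by (simp add: scaleR_conv_of_real algebra_simps)
  moreover have "u * (p + q) - q = t"
    using pq by (simp add: u_def)
  ultimately have "c * complex_of_real t \<in> num_range D S"
    by simp
  then obtain v where v: "v \<in> S" "norm v = 1" "cinner (D v) v = c * complex_of_real t"
    by (auto simp: num_range_def)
  have vG: "cinner v g = 0" if "g \<in> G" for g
    using v(1) that by (auto simp: S_def orth_comp_def)
  have "orthonormal (insert v G)"
    using orthonormal_subset[OF F(2) G(1)] v vG by (intro orthonormal_insert)
  have "v \<notin> G"
    using vG[of v] v(2) by (auto simp: cinner_self)
  then have "(\<Sum>y\<in>insert v G. cinner (D y) y) = c * complex_of_real t + (\<Sum>y\<in>G. cinner (D y) y)"
    using finG v by simp
  also have "(\<Sum>y\<in>G. cinner (D y) y) = (\<Sum>y\<in>G. c * complex_of_real ((norm (P y))\<^sup>2))"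
    using F(3) G(1) by (intro sum.cong refl cinner_ray_space) auto
  also have "\<dots> = c * complex_of_real (r / 2 - t)"
    by (simp add: t_def sum_distrib_left)
  also have "c * complex_of_real t + c * complex_of_real (r / 2 - t) = w"
    unfolding w by (simp add: algebra_simps)
  finally have sum: "(\<Sum>y\<in>insert v G. cinner (D y) y) = w" .
  have "insert v G \<subseteq> orth_comp X"
    using v(1) F(3) G(1) by (auto simp: S_def orth_comp_def)
  with sum finG \<open>orthonormal (insert v G)\<close> show ?thesis
    by blast
qed

lemma zero_diagonal_if_unbounded:
  assumes sep: "separable_space (euclidean :: 'a topology)"
    and unb: "\<And>C. \<not> hs_bounded UNIV (\<lambda>x. D x - P x) C"
  shows "zero_diagonal D"
  unfolding zero_diagonal_def
proof (rule orthonormal_basis_by_extension[OF sep])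
  fix S :: "'a set" and x
  assume S: "finite S" "orthonormal S" "\<forall>e\<in>S. cinner (D e) e = 0"
  show "\<exists>S'. finite S' \<and> orthonormal S' \<and> (\<forall>e\<in>S'. cinner (D e) e = 0) \<and> S \<subseteq> S' \<and> x \<in> cspan S'"
  proof (cases "x \<in> cspan S")
    case True
    with S show ?thesis by blast
  next
    case False
    obtain z where z: "orthonormal (insert z S)" "cspan (insert z S) = cspan (insert x S)"
        "\<And>e. e \<in> S \<Longrightarrow> cinner z e = 0" "norm z = 1"
      using gram_schmidt_insert[OF S(1,2) False] by blast
    \<comment> \<open>\<open>F\<close> cancels the diagonal entry at \<open>z\<close>. It is
      orthogonal to \<open>S\<close>, so rotating \<open>z\<close> and \<open>F\<close> into a
      zero-diagonal set leaves the vectors of \<open>S\<close> untouched.\<close>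
    obtain F where F: "finite F" "orthonormal F" "F \<subseteq> orth_comp (insert z S)"
        "(\<Sum>y\<in>F. cinner (D y) y) = - cinner (D z) z"
      using trace_realisation[OF unb, of "insert z S" "- cinner (D z) z"] S by auto
    have Fz: "cinner y z = 0" and FS: "\<And>e. e \<in> S \<Longrightarrow> cinner y e = 0" if "y \<in> F" for y
      using F(3) that by (auto simp: orth_comp_def)
    have "z \<notin> F"
      using Fz[of z] z(4) by (auto simp: cinner_self)
    moreover have "orthonormal (insert z F)"
      using F z Fz by (intro orthonormal_insert) (auto simp: cinner_eq_0_commute[of z])
    ultimately obtain G where G: "finite G" "orthonormal G" "cspan G = cspan (insert z F)"
        "\<forall>g\<in>G. cinner (D g) g = 0"
      using trace_zero_imp_zero_diagonal[OF D_lin, of "insert z F"] F by auto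
    have GS: "cinner e g = 0" if "e \<in> S" "g \<in> G" for e g
    proof (rule orthogonal_cspan)
      show "g \<in> cspan (insert z F)"
        using G(3) that complex_vector.span_base by blast
      show "cinner e y = 0" if "y \<in> insert z F" for y
        using that z(3)[OF \<open>e \<in> S\<close>] FS[OF _ \<open>e \<in> S\<close>] cinner_eq_0_commute[of e y] by auto
    qed
    have "z \<in> cspan G"
      unfolding G(3) by (rule complex_vector.span_base) simp
    then have "insert z S \<subseteq> cspan (S \<union> G)"
      using complex_vector.span_mono[of G "S \<union> G"] complex_vector.span_superset[of "S \<union> G"] by auto
    then have "cspan (insert z S) \<subseteq> cspan (S \<union> G)"
      by (rule complex_vector.span_minimal) (rule complex_vector.subspace_span)
    moreover have "x \<in> cspan (insert z S)"
      unfolding z(2) by (rule complex_vector.span_base) simp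
    ultimately show ?thesis
      using S G orthonormal_Un[OF S(2) G(2) GS] by (intro exI[of _ "S \<union> G"]) auto
  qed
qed

section \<open>The Hilbert-Schmidt condition on \<open>D - P\<close> and its conflict with a zero
  diagonal\<close>

lemma hs_bounded_D_minus_P:
  assumes pert: "hs_perturbation_of_projection D"
  shows "\<exists>C. hs_bounded UNIV (\<lambda>x. D x - P x) C"
proof -
  from pert obtain P' K where P': "projection P'" and K: "hilbert_schmidt K"
    and DPK: "D = (\<lambda>x. P' x + K x)"
    unfolding hs_perturbation_of_projection_def by blast
  from K obtain C where C: "hs_bounded UNIV K C"
    using hilbert_schmidt_hs_bounded by blast
  have norm_flip: "norm (cinner x y) = norm (cinner y x)" for x y :: 'a
    by (metis cinner_commute complex_mod_cnj)
  have "(\<Sum>f\<in>F. (norm (D f - P f))\<^sup>2) \<le> 4 * C" if F: "finite F" "orthonormal F" for F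
  proof -
    have "D x - P x = D (x - P x)" for x
      by (simp add: clinear_diff[OF D_lin] DP)
    then have "(\<lambda>f. D f - P f) ` F \<subseteq> range D"
      by auto
    \<comment> \<open>Taking \<open>G\<close> inside the range of \<open>D\<close> makes both
      \<open>D\<close> and \<open>P\<close> fix its vectors; the self-adjoint part of
      \<open>D\<close> then cancels in \<open>split\<close>.\<close>
    then obtain G where G: "finite G" "orthonormal G" "G \<subseteq> range D"
        "(\<lambda>f. D f - P f) ` F \<subseteq> cspan G"
      using finite_orthonormal_spanning[of "(\<lambda>f. D f - P f) ` F" "range D"] F
        csubspace_range[OF D_lin] by (metis finite_imageI)
    have split: "cinner (D f - P f) g = cinner (K f) g - cinner f (K g)" if "g \<in> G" for f g
    proof -
      have g: "D g = g" "P g = g"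
        using G(3) that DD PD by auto
      have "cinner (D f - P f) g = cinner (D f) g - cinner f g"
        by (simp add: cinner_diff_left P_adj g)
      also have "\<dots> = cinner (D f) g - cinner f (D g)"
        by (simp add: g)
      also have "\<dots> = cinner (K f) g - cinner f (K g)"
        using P' by (simp add: DPK cinner_add_left cinner_add_right projection_def is_cadjoint_def)
      finally show ?thesis .
    qed
    have "(\<Sum>f\<in>F. (norm (D f - P f))\<^sup>2) = (\<Sum>f\<in>F. \<Sum>g\<in>G. (norm (cinner (K f) g - cinner f (K g)))\<^sup>2)"
      using G by (intro sum.cong refl) (auto simp: parseval[OF G(1,2)] split)
    also have "\<dots> \<le> (\<Sum>f\<in>F. \<Sum>g\<in>G. 2 * (norm (cinner (K f) g))\<^sup>2 + 2 * (norm (cinner f (K g)))\<^sup>2)"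
    proof (intro sum_mono)
      fix f g
      let ?a = "norm (cinner (K f) g)" and ?b = "norm (cinner f (K g))"
      have "(norm (cinner (K f) g - cinner f (K g)))\<^sup>2 \<le> (?a + ?b)\<^sup>2"
        by (intro power_mono norm_triangle_ineq4) auto
      also have "\<dots> \<le> 2 * ?a\<^sup>2 + 2 * ?b\<^sup>2"
        using zero_le_power2[of "?a - ?b"] unfolding power2_sum power2_diff by linarith
      finally show "(norm (cinner (K f) g - cinner f (K g)))\<^sup>2 \<le> 2 * ?a\<^sup>2 + 2 * ?b\<^sup>2" .
    qed
    \<comment> \<open>Exchanging the sums in the second term turns it into Bessel sums of
      \<open>K g\<close> over \<open>F\<close>, so no bound on the adjoint of \<open>K\<close> is
      required.\<close>
    also have "\<dots> = 2 * (\<Sum>f\<in>F. \<Sum>g\<in>G. (norm (cinner (K f) g))\<^sup>2)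
        + 2 * (\<Sum>g\<in>G. \<Sum>f\<in>F. (norm (cinner (K g) f))\<^sup>2)"
      by (subst (3) sum.swap)
        (simp add: sum.distrib sum_distrib_left norm_flip[of f "K g" for f g])
    also have "\<dots> \<le> 2 * (\<Sum>f\<in>F. (norm (K f))\<^sup>2) + 2 * (\<Sum>g\<in>G. (norm (K g))\<^sup>2)"
      by (intro add_mono mult_left_mono sum_mono bessel F G) auto
    also have "\<dots> \<le> 2 * C + 2 * C"
      using C F G by (intro add_mono mult_left_mono) (auto simp: hs_bounded_def)
    finally show ?thesis
      by simp
  qed
  then show ?thesis
    unfolding hs_bounded_def by blast
qed

lemma hs_bounded_zero_diagonal_imp_zero:
  assumes C: "hs_bounded UNIV (\<lambda>x. D x - P x) C" and "zero_diagonal D"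
  shows "D x = 0"
proof -
  obtain E where E: "orthonormal_basis E" "\<And>e. e \<in> E \<Longrightarrow> cinner (D e) e = 0"
    using assms(2) unfolding zero_diagonal_def by blast
  have oE: "orthonormal S" if "S \<subseteq> E" for S
    using E(1) that orthonormal_subset by (auto simp: orthonormal_basis_iff)
  \<comment> \<open>Zero diagonal gives \<open>cinner (P e) e = - cinner (D e - P e) e\<close>, and
    the second argument may be replaced by \<open>P e\<close> because \<open>P\<close> fixes
    \<open>D e - P e\<close>.\<close>
  have Pe: "norm (P e) \<le> norm (D e - P e)" if "e \<in> E" for e
  proof (cases "norm (P e) = 0")
    case False
    have "complex_of_real ((norm (P e))\<^sup>2) = - cinner (D e - P e) e"
      by (simp add: cinner_diff_left E(2)[OF that] cinner_P)
    also have "cinner (D e - P e) e = cinner (D e - P e) (P e)"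
      using P_adj[of "D e - P e" e] by (simp add: clinear_diff[OF P_lin] PD PP)
    finally have "norm (complex_of_real ((norm (P e))\<^sup>2)) = norm (cinner (D e - P e) (P e))"
      by simp
    also have "\<dots> \<le> norm (D e - P e) * norm (P e)"
      by (rule norm_cinner_le)
    finally have "norm (P e) * norm (P e) \<le> norm (D e - P e) * norm (P e)"
      by (simp add: power2_eq_square norm_mult)
    then show ?thesis
      using False by (simp add: mult_le_cancel_right)
  qed simp
  \<comment> \<open>The rank is bounded: the cardinality of \<open>F\<close> is a limit of finite
    double sums which, summed over \<open>F\<close> first, are at most the square sum of
    \<open>P e\<close> and hence of \<open>D e - P e\<close>.\<close>
  have card_le: "real (card F) \<le> C" if F: "finite F" "orthonormal F" "F \<subseteq> range D" for F
  proof (rule tendsto_upperbound)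
    have "(\<Sum>f\<in>F. (norm f)\<^sup>2) = real (card F)"
      using orthonormal_norm[OF F(2)] by simp
    moreover have "((\<lambda>S. \<Sum>f\<in>F. (norm (oproj S f))\<^sup>2) \<longlongrightarrow> (\<Sum>f\<in>F. (norm f)\<^sup>2))
        (finite_subsets_at_top E)"
      by (intro tendsto_intros oproj_tendsto E)
    ultimately show "((\<lambda>S. \<Sum>f\<in>F. (norm (oproj S f))\<^sup>2) \<longlongrightarrow> real (card F))
        (finite_subsets_at_top E)"
      by simp
    have le: "(\<Sum>f\<in>F. (norm (oproj S f))\<^sup>2) \<le> C" if S: "finite S" "S \<subseteq> E" for S
    proof -
      have "norm (cinner f e) = norm (cinner (P e) f)" if "f \<in> F" for f e
      proof -
        have "P f = f"
          using F(3) that PD by auto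
        then have "cinner f e = cnj (cinner (P e) f)"
          using P_adj[of f e] cinner_commute[of f "P e"] by simp
        then show ?thesis
          by simp
      qed
      then have "(\<Sum>f\<in>F. (norm (oproj S f))\<^sup>2) = (\<Sum>f\<in>F. \<Sum>e\<in>S. (norm (cinner (P e) f))\<^sup>2)"
        by (simp add: norm_oproj[OF S(1) oE[OF S(2)]])
      also have "\<dots> = (\<Sum>e\<in>S. \<Sum>f\<in>F. (norm (cinner (P e) f))\<^sup>2)"
        by (rule sum.swap)
      also have "\<dots> \<le> (\<Sum>e\<in>S. (norm (P e))\<^sup>2)"
        by (intro sum_mono bessel F)
      also have "\<dots> \<le> (\<Sum>e\<in>S. (norm (D e - P e))\<^sup>2)"
        using S Pe by (intro sum_mono power_mono) auto
      also have "\<dots> \<le> C"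
        using C S oE[OF S(2)] by (simp add: hs_bounded_def)
      finally show ?thesis .
    qed
    show "\<forall>\<^sub>F S in finite_subsets_at_top E. (\<Sum>f\<in>F. (norm (oproj S f))\<^sup>2) \<le> C"
      unfolding eventually_finite_subsets_at_top using le by (intro exI[of _ "{}"]) auto
  qed simp
  define R where "R F \<longleftrightarrow> finite F \<and> orthonormal F \<and> F \<subseteq> range D" for F
  have "card F \<le> nat \<lfloor>C\<rfloor>" if "R F" for F
    using card_le[of F] that by (simp add: R_def le_nat_floor)
  moreover have "R {}"
    by (simp add: R_def)
  \<comment> \<open>An orthonormal set in the range of largest cardinality must span the
    range.\<close>
  ultimately have "\<exists>F. R F \<and> (\<forall>G. R G \<longrightarrow> card G \<le> card F)"
    by (intro ex_has_greatest_nat[of R "{}" card "Suc (nat \<lfloor>C\<rfloor>)"]) (auto simp: less_Suc_eq_le)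
  then obtain F where F: "R F" "\<And>G. R G \<Longrightarrow> card G \<le> card F"
    by blast
  have finF: "finite F" "orthonormal F" "F \<subseteq> range D"
    using F(1) by (auto simp: R_def)
  have span: "D y \<in> cspan F" for y
  proof (rule ccontr)
    assume "D y \<notin> cspan F"
    then obtain z where z: "orthonormal (insert z F)" "cspan (insert z F) = cspan (insert (D y) F)"
        "\<And>e. e \<in> F \<Longrightarrow> cinner z e = 0" "norm z = 1"
      using gram_schmidt_insert[OF finF(1,2)] by blast
    have "z \<in> cspan (insert (D y) F)"
      unfolding z(2)[symmetric] by (rule complex_vector.span_base) simp
    also have "\<dots> \<subseteq> range D"
      using finF(3) csubspace_range[OF D_lin] by (intro complex_vector.span_minimal) auto
    finally have "R (insert z F)"
      using z F(1) by (simp add: R_def)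
    moreover have "z \<notin> F"
      using z(3)[of z] z(4) by (auto simp: cinner_self)
    ultimately show False
      using F(2)[of "insert z F"] F(1) by (simp add: R_def)
  qed
  \<comment> \<open>Both sides of the trace identity at a finite stage: as \<open>D e\<close> lies
    in the span of \<open>F\<close>, the sum over \<open>F\<close> equals the diagonal sum over
    \<open>S\<close>. In the limit the trace over \<open>F\<close>, which is its cardinality,
    becomes 0.\<close>
  have zero: "(\<Sum>f\<in>F. cinner (D (oproj S f)) f) = 0" if S: "finite S" "S \<subseteq> E" for S
  proof -
    have "(\<Sum>f\<in>F. cinner (D (oproj S f)) f) = (\<Sum>f\<in>F. \<Sum>e\<in>S. cinner f e * cinner (D e) f)"
      by (simp add: oproj_def clinear_sum[OF D_lin] clinear_scaleC[OF D_lin] cinner_sum_left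
          cinner_scaleC_left)
    also have "\<dots> = (\<Sum>e\<in>S. cinner (oproj F (D e)) e)"
      by (subst sum.swap) (simp add: oproj_def cinner_sum_left cinner_scaleC_left mult.commute)
    also have "\<dots> = (\<Sum>e\<in>S. cinner (D e) e)"
      by (simp add: oproj_cspan[OF finF(1,2) span])
    also have "\<dots> = 0"
      using S E(2) by (intro sum.neutral) auto
    finally show ?thesis .
  qed
  have "((\<lambda>S. \<Sum>f\<in>F. cinner (D (oproj S f)) f) \<longlongrightarrow> (\<Sum>f\<in>F. cinner (D f) f))
      (finite_subsets_at_top E)"
    by (intro tendsto_sum tendsto_cinner_left bounded_linear.tendsto[OF D_bounded] oproj_tendsto E)
  moreover have "((\<lambda>S. \<Sum>f\<in>F. cinner (D (oproj S f)) f) \<longlongrightarrow> 0) (finite_subsets_at_top E)"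
    by (rule tendsto_eventually, unfold eventually_finite_subsets_at_top)
      (use zero in \<open>auto intro!: exI[of _ "{}"]\<close>)
  ultimately have "(\<Sum>f\<in>F. cinner (D f) f) = 0"
    by (intro tendsto_unique[OF finite_subsets_at_top_neq_bot])
  moreover have "cinner (D f) f = 1" if "f \<in> F" for f
  proof -
    have "D f = f"
      using finF(3) that DD by auto
    then show ?thesis
      using orthonormal_cinner[OF finF(2) that that] by simp
  qed
  ultimately have "complex_of_nat (card F) = 0"
    by simp
  then have "F = {}"
    using finF by simp
  then show ?thesis
    using span[of x] by simp
qed

end

section \<open>The equivalence for nonzero idempotents\<close>

theorem corollary2p6:
  fixes D :: "'a::chilbert_space \<Rightarrow> 'a"
  assumes "cfinite_dim (UNIV :: 'a set) \<or>
      (separable_space (euclidean :: 'a topology) \<and> \<not> cfinite_dim (UNIV :: 'a set))"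
    and "bounded_clinear D"
    and "D \<circ> D = D"
    and "D \<noteq> (\<lambda>x. 0)"
  shows "zero_diagonal D \<longleftrightarrow> \<not> hs_perturbation_of_projection D"
proof -
  have DD: "D (D x) = D x" for x
    using assms(3) by (metis comp_apply)
  have lin: "clinear D" "bounded_linear D"
    using assms(2) by (simp_all add: bounded_clinear_iff)
  have range: "range D = {x. D x = x}"
    using DD by (auto simp: image_iff) metis
  \<comment> \<open>The range of an idempotent is its set of fixed points, closed by
    continuity.\<close>
  have "closed (range D)"
    unfolding range by (intro closed_Collect_eq continuous_intros linear_continuous_on lin)
  then obtain P where P: "projection P" "\<And>x. P x \<in> range D" "\<And>x. x \<in> range D \<Longrightarrow> P x = x"
    using projection_exists csubspace_range[OF lin(1)] by blast
  interpret idempotent D P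
  proof
    show "D (P x) = P x" for x
      using P(2)[of x] unfolding range by blast
  qed (use assms(2) DD P in auto)
  show ?thesis
  proof
    assume "zero_diagonal D"
    then show "\<not> hs_perturbation_of_projection D"
      using hs_bounded_D_minus_P hs_bounded_zero_diagonal_imp_zero assms(4) by blast
  next
    assume not: "\<not> hs_perturbation_of_projection D"
    have not_bounded: "\<not> hs_bounded UNIV (\<lambda>x. D x - P x) C" if "orthonormal_basis E" for E :: "'a set" and C
    proof
      assume "hs_bounded UNIV (\<lambda>x. D x - P x) C"
      then have "hilbert_schmidt (\<lambda>x. D x - P x)"
        by (rule hilbert_schmidtI[OF D_minus_P that])
      then have "hs_perturbation_of_projection D"
        unfolding hs_perturbation_of_projection_def using P(1)
        by (intro exI[of _ P] exI[of _ "\<lambda>x. D x - P x"]) auto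
      with not show False
        by blast
    qed
    \<comment> \<open>Over a finite basis \<open>D - P\<close> is trivially Hilbert-Schmidt, so the
      assumption \<open>not\<close> leaves only the separable infinite dimensional case.\<close>
    have "\<not> cfinite_dim (UNIV :: 'a set)"
    proof
      assume "cfinite_dim (UNIV :: 'a set)"
      then obtain E :: "'a set" where "finite E" "orthonormal_basis E"
        using finite_orthonormal_basis_exists by blast
      then have "hilbert_schmidt (\<lambda>x. D x - P x)"
        unfolding hilbert_schmidt_def using D_minus_P by auto
      then show False
        using not_bounded[OF \<open>orthonormal_basis E\<close>] hilbert_schmidt_hs_bounded by blast
    qed
    then have sep: "separable_space (euclidean :: 'a topology)"
      using assms(1) by blast
    then show "zero_diagonal D"
      using zero_diagonal_if_unbounded not_bounded orthonormal_basis_exists by blast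
  qed
qed

end
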